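(* Let $\nu$ be a nonzero finite positive Borel measure supported in a compact interval $[a,b]\subset(0,1)$ and put $$k_\nu(t)=\int_{(0,1)}h_{1-\alpha}(t)\,d\nu(\alpha),\qquad t>0.$$ Then the kernel $k_\nu$ has a completely monotone Sonine associate $\kappa_\nu\in L^1_{\mathrm{loc}}$ satisfying $$\widehat\kappa_\nu(z)=\left(\int_{[a,b]}z^\alpha\,d\nu(\alpha)\right)^{-1},\qquad z>0 .$$ Moreover, $\kappa_\nu(t)>0$ for $t>0$ and, for every $T>0$, there is a constant $C_T$ with $$0<\kappa_\nu(t)\le C_Tt^{a-1},\qquad 0<t\le T .$$ Thus, for every $T>0$: $\kappa_\nu,k_\nu\in L^1(0,T)$ form a Sonine pair on $(0,T]$, $|\kappa_\nu(t)|\le C t^{\eta-1}$ on $(0,T]$ for some $C,\eta>0$, and $\kappa_\nu$ does not vanish almost everywhere on any interval $(0,\varepsilon)$, $\varepsilon>0$ (so that the convolution operator $V_{\kappa_\nu}$ is injective on $C[0,T]$).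
   Context: For $\beta>0$, $h_\beta(t)=t^{\beta-1}/\Gamma(\beta)$, $t>0$. $L^1_{\mathrm{loc}}$ here means functions on $(0,\infty)$ integrable on $(0,T)$ for every $T>0$. $\kappa_\nu$ is a Sonine associate of $k_\nu$ (equivalently $(\kappa_\nu,k_\nu)$ is a Sonine pair) if $(\kappa_\nu*k_\nu)(t)=\int_0^t\kappa_\nu(t-s)k_\nu(s)\,ds=1$ for $t>0$. $\widehat\kappa(z)=\int_0^\infty e^{-zt}\kappa(t)\,dt$ is the Laplace transform. $V_\kappa f(t)=\int_0^t\kappa(t-s)f(s)\,ds$. *)

theory Defs
  imports "HOL-Analysis.Analysis"
begin

definition h_ker :: "real \<Rightarrow> real \<Rightarrow> real" where
  "h_ker \<beta> t = t powr (\<beta> - 1) / Gamma \<beta>"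

definition k_ker :: "real measure \<Rightarrow> real \<Rightarrow> real" where
  "k_ker \<nu> t = (LINT \<alpha>:{0<..<1}|\<nu>. h_ker (1 - \<alpha>) t)"

text \<open>Kernels are functions on the open half-line; values at nonpositive arguments are
  irrelevant in every notion below.\<close>

definition L1_on :: "real \<Rightarrow> (real \<Rightarrow> real) \<Rightarrow> bool" where
  "L1_on T f \<longleftrightarrow> set_integrable lborel {0<..<T} f"

definition L1_loc :: "(real \<Rightarrow> real) \<Rightarrow> bool" where
  "L1_loc f \<longleftrightarrow> (\<forall>T>0. L1_on T f)"

definition volterra ::
  "(real \<Rightarrow> real) \<Rightarrow> (real \<Rightarrow> 'b::{banach, second_countable_topology}) \<Rightarrow> real \<Rightarrow> 'b" where
  "volterra \<kappa> f t = (LBINT s:{0<..<t}. \<kappa> (t - s) *\<^sub>R f s)"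

text \<open>For a real-valued second argument, \<^const>\<open>volterra\<close> is the convolution of two kernels.
  A Bochner integral of a non-integrable function is 0, so the value 1 forces the
  convolution integral to converge absolutely.\<close>

definition sonine_pair_on :: "real set \<Rightarrow> (real \<Rightarrow> real) \<Rightarrow> (real \<Rightarrow> real) \<Rightarrow> bool" where
  "sonine_pair_on S \<kappa> k \<longleftrightarrow> (\<forall>t\<in>S. volterra \<kappa> k t = 1)"

definition laplace :: "(real \<Rightarrow> real) \<Rightarrow> real \<Rightarrow> real" where
  "laplace f z = (LBINT t:{0<..}. exp (- z * t) * f t)"

definition completely_monotone :: "(real \<Rightarrow> real) \<Rightarrow> bool" where
  "completely_monotone f \<longleftrightarrow>
     (\<forall>n. \<forall>t>0. (deriv ^^ n) f differentiable (at t) \<and> (-1) ^ n * (deriv ^^ n) f t \<ge> 0)"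

text \<open>Elements of $C[0,T]$ are represented by functions on the reals that are continuous on
  the interval, two of them being identified if they agree there.  The type argument fixes
  the scalars.\<close>

definition volterra_inj_on_C ::
  "'b::{banach, second_countable_topology} itself \<Rightarrow> real \<Rightarrow> (real \<Rightarrow> real) \<Rightarrow> bool" where
  "volterra_inj_on_C _ T \<kappa> \<longleftrightarrow>
     (\<forall>(f :: real \<Rightarrow> 'b) g. continuous_on {0..T} f \<longrightarrow> continuous_on {0..T} g \<longrightarrow>
        (\<forall>t\<in>{0..T}. volterra \<kappa> f t = volterra \<kappa> g t) \<longrightarrow> (\<forall>t\<in>{0..T}. f t = g t))"

end

theory Submission
  imports Defs "HOL-Complex_Analysis.Complex_Analysis" "HOL-Real_Asymp.Real_Asymp"
begin

text \<open>
  Put \<open>P z = \<integral> z\<^sup>\<alpha> d\<nu>(\<alpha>)\<close>.  Since the Laplace transform of \<open>k_ker \<nu>\<close> is \<open>P z / z\<close>, a Sonine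
  associate has to have the Laplace transform \<open>1 / P z\<close>.  All assertions follow once this function
  is exhibited as the Stieltjes transform of a positive density, because a Stieltjes transform
  is an iterated Laplace transform.

  The density is the jump of \<open>1 / P\<close> across the negative half-line.  In the logarithmic coordinate
  \<open>z = exp \<zeta>\<close> the multivalued function \<open>P\<close> becomes the entire function
  \<open>symbol \<zeta> = \<integral> exp (\<alpha> \<zeta>) d\<nu>(\<alpha>)\<close>, and the slit plane becomes the strip \<open>\<bar>Im \<zeta>\<bar> < pi\<close>.  All orders lie in
  an interval of length \<open>b - a < 1\<close>, so on the closed strip the phases of \<open>exp (\<alpha> \<zeta>)\<close> lie in an arc
  shorter than \<open>pi\<close> and cannot cancel; this gives \<open>\<bar>symbol \<zeta>\<bar> \<ge> cos (pi (b - a) / 2) P (exp (Re \<zeta>))\<close>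
  (\<open>norm_symbol_ge\<close>).  The residue theorem for \<open>exp \<zeta> / (symbol \<zeta> (exp \<zeta> - z))\<close> on the rectangles
  \<open>[-R, R] \<times> [-pi, pi]\<close> then yields
  \<open>1 / P z = \<integral> spectral_density x / (exp x + z) dx\<close> (\<open>stieltjes_transform_spectral_density\<close>): the
  vertical sides vanish as \<open>R\<close> grows because \<open>a > 0\<close> and \<open>b < 1\<close>, and the horizontal sides give the
  jump.  The density is positive since \<open>sin (pi \<alpha>) > 0\<close> for \<open>0 < \<alpha> < 1\<close>.  Accordingly
  \<open>sonine_kernel t = \<integral> exp (- t exp x) spectral_density x dx\<close> is positive and completely monotone, and
  has the Laplace transform \<open>1 / P\<close>.

  It remains to pass from the product of the two Laplace transforms, which is \<open>1 / z\<close>, to the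
  convolution \<open>H\<close> of the two kernels at every point (\<open>volterra_eq_1_if_laplace\<close>).  Both kernels
  are nonincreasing, hence so is \<open>H t / t\<close>; if \<open>H\<close> were different from 1 at one point, it would stay
  strictly above 1 on an interval to the left of it or strictly below 1 on an interval to the right
  of it, and a Weierstrass approximation argument in the variable \<open>exp (- t)\<close> shows that a function with vanishing Laplace transform cannot be positive
  on an interval.

  The estimate of the kernel follows from monotonicity:
  \<open>t \<kappa>(t) \<le> e \<integral> exp (- s / t) \<kappa>(s) ds = e / P (1 / t)\<close>, where \<open>P (1 / t)\<close> is, for \<open>t\<close> in a
  bounded set, at least a positive multiple of \<open>t powr (- a)\<close>.  Injectivity of the convolution
  operator holds because convolving once more with \<open>k_ker \<nu>\<close> turns it into integration.
\<close>

section \<open>Differentiation under the integral and complete monotonicity\<close>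

text \<open>Dominated convergence for difference quotients.  Stating it over a normed field covers both the
  real derivatives needed for complete monotonicity and the holomorphy of the symbol.\<close>
lemma has_field_derivative_integral:
  fixes f f' :: "'k::{real_normed_field,banach,second_countable_topology} \<Rightarrow> 'a \<Rightarrow> 'k"
  assumes r: "0 < r"
    and int: "\<And>z. z \<in> ball z0 r \<Longrightarrow> integrable M (f z)"
    and der: "AE x in M. \<forall>z\<in>ball z0 r. ((\<lambda>z. f z x) has_field_derivative f' z x) (at z)"
    and bnd: "AE x in M. \<forall>z\<in>ball z0 r. norm (f' z x) \<le> g x"
    and g: "integrable M g"
    and meas: "f' z0 \<in> borel_measurable M"
  shows "((\<lambda>z. LINT x|M. f z x) has_field_derivative (LINT x|M. f' z0 x)) (at z0)"
  unfolding has_field_derivative_iff tendsto_at_iff_sequentially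
proof (intro allI impI)
  fix X :: "nat \<Rightarrow> 'k"
  assume X: "\<forall>i. X i \<in> UNIV - {z0}" and lim: "X \<longlonglongrightarrow> z0"
  from lim r have "\<forall>\<^sub>F i in sequentially. X i \<in> ball z0 r"
    by (metis centre_in_ball open_ball topological_tendstoD)
  then obtain N where N: "\<And>i. i \<ge> N \<Longrightarrow> X i \<in> ball z0 r"
    by (auto simp: eventually_sequentially)
  \<comment> \<open>The hypotheses are available only inside the ball, so the first terms of the sequence are
    dropped.\<close>
  define Y where "Y i = X (i + N)" for i
  have Y: "Y i \<in> ball z0 r" "Y i \<noteq> z0" for i
    using X N by (auto simp: Y_def)
  have Ylim: "Y \<longlonglongrightarrow> z0"
    unfolding Y_def using lim by (rule LIMSEQ_ignore_initial_segment)
  have z0: "z0 \<in> ball z0 r" using r by simp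
  have "(\<lambda>i. LINT x|M. (f (Y i) x - f z0 x) / (Y i - z0)) \<longlonglongrightarrow> (LINT x|M. f' z0 x)"
  proof (rule integral_dominated_convergence[OF meas _ g])
    show "(\<lambda>x. (f (Y i) x - f z0 x) / (Y i - z0)) \<in> borel_measurable M" for i
      using int[OF Y(1)] int[OF z0] by (intro borel_measurable_divide borel_measurable_diff) auto
    show "AE x in M. (\<lambda>i. (f (Y i) x - f z0 x) / (Y i - z0)) \<longlonglongrightarrow> f' z0 x"
      using der
    proof eventually_elim
      case (elim x)
      then have "((\<lambda>z. (f z x - f z0 x) / (z - z0)) \<longlongrightarrow> f' z0 x) (at z0)"
        using z0 by (auto simp: has_field_derivative_iff)
      then show ?case
        unfolding tendsto_at_iff_sequentially using Y Ylim by (auto simp: comp_def)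
    qed
    show "AE x in M. norm ((f (Y i) x - f z0 x) / (Y i - z0)) \<le> g x" for i
      using der bnd
    proof eventually_elim
      case (elim x)
      have "norm (f (Y i) x - f z0 x) \<le> g x * norm (Y i - z0)"
      proof (rule field_differentiable_bound[OF convex_ball, where f = "\<lambda>z. f z x" and f' = "\<lambda>z. f' z x"])
        show "((\<lambda>z. f z x) has_field_derivative f' z x) (at z within ball z0 r)"
          if "z \<in> ball z0 r" for z using elim that by (auto intro: has_field_derivative_at_within)
      qed (use elim Y z0 in auto)
      then show ?case using Y(2) by (simp add: norm_divide field_simps)
    qed
  qed
  also have "(\<lambda>i. LINT x|M. (f (Y i) x - f z0 x) / (Y i - z0)) =
      (\<lambda>i. ((LINT x|M. f (Y i) x) - (LINT x|M. f z0 x)) / (Y i - z0))"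
    using int[OF Y(1)] int[OF z0] by (simp add: Bochner_Integration.integral_diff)
  finally have "(\<lambda>i. ((\<lambda>z. ((LINT x|M. f z x) - (LINT x|M. f z0 x)) / (z - z0)) \<circ> X) (i + N))
      \<longlonglongrightarrow> (LINT x|M. f' z0 x)"
    by (simp add: Y_def comp_def)
  then show "((\<lambda>z. ((LINT x|M. f z x) - (LINT x|M. f z0 x)) / (z - z0)) \<circ> X)
      \<longlonglongrightarrow> (LINT x|M. f' z0 x)"
    by (rule LIMSEQ_offset)
qed

text \<open>A power can be absorbed into an arbitrarily small part of the exponential decay, with a constant
  that does not depend on \<open>x\<close>.\<close>
lemma power_le_exp_mult:
  fixes s x :: real
  assumes "0 < s" "0 \<le> x"
  shows "x ^ n \<le> ((real n + 1) / s) ^ n * exp (s * x)"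
proof -
  define y where "y = s * x / (real n + 1)"
  have y: "0 \<le> y" using assms by (simp add: y_def)
  have "x ^ n = ((real n + 1) / s) ^ n * y ^ n"
    using assms by (simp add: y_def flip: power_mult_distrib)
  also have "y ^ n \<le> exp y ^ n"
    using exp_ge_add_one_self[of y] y by (intro power_mono) linarith+
  also have "exp y ^ n = exp (real n * y)" by (simp add: exp_of_nat_mult)
  also have "\<dots> \<le> exp (s * x)" using assms
    by (simp add: y_def divide_simps) (simp add: algebra_simps)
  finally show ?thesis using assms by (simp add: mult_left_mono)
qed

text \<open>The easy half of Bernstein's theorem: each differentiation of \<open>exp (- t u)\<close> brings down a factor
  \<open>- u\<close>.  The mixing measure has density \<open>w\<close> and is pushed forward along \<open>u\<close>, which allows it
  to be parametrised by a logarithmic variable.\<close>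
context
  fixes M :: "'a measure" and u w :: "'a \<Rightarrow> real"
  assumes u[measurable]: "u \<in> borel_measurable M" and w[measurable]: "w \<in> borel_measurable M"
    and u_nonneg: "\<And>x. 0 \<le> u x" and w_nonneg: "\<And>x. 0 \<le> w x"
    and int: "\<And>t. 0 < t \<Longrightarrow> integrable M (\<lambda>x. exp (- t * u x) * w x)"
begin

lemma integrable_power_laplace_mixture:
  assumes "0 < t"
  shows "integrable M (\<lambda>x. u x ^ n * (exp (- t * u x) * w x))"
proof (rule Bochner_Integration.integrable_bound)
  show "integrable M (\<lambda>x. ((real n + 1) / (t/2)) ^ n * (exp (- (t/2) * u x) * w x))"
    using int[of "t/2"] assms by simp
  show "AE x in M. norm (u x ^ n * (exp (- t * u x) * w x))
      \<le> norm (((real n + 1) / (t/2)) ^ n * (exp (- (t/2) * u x) * w x))"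
  proof (intro AE_I2)
    fix x
    have "u x ^ n * exp (- t * u x) \<le> (((real n + 1) / (t/2)) ^ n * exp ((t/2) * u x)) * exp (- t * u x)"
      using assms u_nonneg by (intro mult_right_mono power_le_exp_mult) auto
    also have "\<dots> = ((real n + 1) / (t/2)) ^ n * exp (- (t/2) * u x)"
      by (simp add: field_simps flip: exp_add)
    finally have "u x ^ n * exp (- t * u x) * w x \<le> ((real n + 1) / (t/2)) ^ n * exp (- (t/2) * u x) * w x"
      using w_nonneg by (rule mult_right_mono)
    then show "norm (u x ^ n * (exp (- t * u x) * w x))
      \<le> norm (((real n + 1) / (t/2)) ^ n * (exp (- (t/2) * u x) * w x))"
      using w_nonneg[of x] u_nonneg[of x] assms by (simp add: abs_mult mult.assoc)
  qed
qed measurable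

lemma laplace_mixture_has_derivative:
  assumes "0 < t"
  shows "((\<lambda>t. LINT x|M. u x ^ n * (exp (- t * u x) * w x)) has_field_derivative
      - (LINT x|M. u x ^ Suc n * (exp (- t * u x) * w x))) (at t)"
proof -
  have "((\<lambda>t. LINT x|M. u x ^ n * (exp (- t * u x) * w x)) has_field_derivative
      (LINT x|M. - (u x ^ Suc n * (exp (- t * u x) * w x)))) (at t)"
  proof (rule has_field_derivative_integral[where r = "t/2" and g = "\<lambda>x. u x ^ Suc n * (exp (- (t/2) * u x) * w x)"
      and f' = "\<lambda>t x. - (u x ^ Suc n * (exp (- t * u x) * w x))"])
    have pos: "t/2 < s" if "s \<in> ball t (t/2)" for s
      using that assms by (auto simp: dist_real_def abs_if split: if_splits)
    show "integrable M (\<lambda>x. u x ^ n * (exp (- s * u x) * w x))" if "s \<in> ball t (t/2)" for s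
      using pos[OF that] assms by (intro integrable_power_laplace_mixture) auto
    show "AE x in M. \<forall>s\<in>ball t (t/2). ((\<lambda>t. u x ^ n * (exp (- t * u x) * w x)) has_field_derivative
        - (u x ^ Suc n * (exp (- s * u x) * w x))) (at s)"
      by (intro AE_I2 ballI) (auto intro!: derivative_eq_intros)
    show "AE x in M. \<forall>s\<in>ball t (t/2). norm (- (u x ^ Suc n * (exp (- s * u x) * w x)))
        \<le> u x ^ Suc n * (exp (- (t/2) * u x) * w x)"
    proof (intro AE_I2 ballI)
      fix x s assume "s \<in> ball t (t/2)"
      from pos[OF this] have "exp (- s * u x) \<le> exp (- (t/2) * u x)"
        using mult_right_mono[of "t/2" s "u x"] u_nonneg[of x] by simp
      then show "norm (- (u x ^ Suc n * (exp (- s * u x) * w x)))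
        \<le> u x ^ Suc n * (exp (- (t/2) * u x) * w x)"
        using u_nonneg[of x] w_nonneg[of x]
        by (simp add: abs_mult mult_left_mono mult_right_mono)
    qed
    show "integrable M (\<lambda>x. u x ^ Suc n * (exp (- (t/2) * u x) * w x))"
      using assms by (intro integrable_power_laplace_mixture) auto
  qed (use assms in auto)
  then show ?thesis by simp
qed

lemma completely_monotone_laplace_mixture:
  "completely_monotone (\<lambda>t. LINT x|M. exp (- t * u x) * w x)"
proof -
  define D where "D n t = (LINT x|M. u x ^ n * (exp (- t * u x) * w x))" for n t
  have der: "(D n has_field_derivative - D (Suc n) t) (at t)" if "0 < t" for n t
    unfolding D_def by (rule laplace_mixture_has_derivative[OF that])
  have step: "((deriv ^^ n) (D 0) has_field_derivative (-1) ^ n * (- D (Suc n) t)) (at t)"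
    if "0 < t" and eq: "\<And>s. 0 < s \<Longrightarrow> (deriv ^^ n) (D 0) s = (-1) ^ n * D n s" for n t
  proof -
    have ev: "\<forall>\<^sub>F s in nhds t. (-1) ^ n * D n s = (deriv ^^ n) (D 0) s"
      using eventually_nhds_in_open[of "{0<..}" t] \<open>0 < t\<close> by (auto simp: eq elim: eventually_mono)
    have "((\<lambda>s. (-1) ^ n * D n s) has_field_derivative (-1) ^ n * (- D (Suc n) t)) (at t)"
      by (intro DERIV_cmult der \<open>0 < t\<close>)
    then show ?thesis using DERIV_cong_ev[OF refl ev refl] by simp
  qed
  have iter: "(deriv ^^ n) (D 0) t = (-1) ^ n * D n t" if "0 < t" for n t
    using that
  proof (induction n arbitrary: t)
    case (Suc n)
    from DERIV_imp_deriv[OF step[OF Suc.prems Suc.IH]] show ?case by simp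
  qed simp
  have "(deriv ^^ n) (D 0) differentiable (at t)" if "0 < t" for n t
    using step[OF that iter] by (auto simp: real_differentiable_def)
  moreover have "(-1) ^ n * (deriv ^^ n) (D 0) t \<ge> 0" if "0 < t" for n t
  proof -
    have "(-1) ^ n * (deriv ^^ n) (D 0) t = D n t"
      by (simp add: iter[OF that] flip: power_add mult.assoc mult_2)
    also have "\<dots> \<ge> 0" unfolding D_def
      using u_nonneg w_nonneg by (intro integral_nonneg_AE) auto
    finally show ?thesis .
  qed
  moreover have "D 0 = (\<lambda>t. LINT x|M. exp (- t * u x) * w x)" by (simp add: D_def fun_eq_iff)
  ultimately show ?thesis unfolding completely_monotone_def by metis
qed

end

section \<open>Uniqueness for Laplace transforms\<close>

text \<open>In the variable \<open>exp (- t)\<close> the Laplace transform at positive integers gives polynomial moments, so by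
  Weierstrass approximation \<open>exp (- t) g t\<close> integrates to zero against every continuous function of
  \<open>exp (- t)\<close>, in particular against a bump that is positive exactly on the given interval.\<close>
lemma zero_laplace_not_positive_on_interval:
  fixes g :: "real \<Rightarrow> real"
  assumes int: "set_integrable lborel {0<..} (\<lambda>t. exp (- t) * g t)"
    and zero: "\<And>n. (LBINT t:{0<..}. exp (- real (Suc n) * t) * g t) = 0"
    and cd: "0 \<le> c" "c < d" and pos: "\<And>t. c < t \<Longrightarrow> t < d \<Longrightarrow> 0 < g t"
  shows False
proof -
  \<comment> \<open>The weight \<open>exp (- t)\<close> is split off from the transform so that constants are among the
    admissible polynomials.\<close>
  define \<phi> where "\<phi> t = indicator {0<..} t * (exp (- t) * g t)" for t :: real
  have \<phi>[simp]: "integrable lborel \<phi>"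
    using int by (simp add: set_integrable_def \<phi>_def[abs_def])
  have [measurable]: "\<phi> \<in> borel_measurable lborel" using \<phi> by (rule borel_measurable_integrable)
  have bnd: "\<bar>exp (-t) ^ n * \<phi> t\<bar> \<le> \<bar>\<phi> t\<bar>" for t n
    by (auto simp: \<phi>_def abs_mult indicator_def power_le_one mult_left_le_one_le)
  have powint: "integrable lborel (\<lambda>t. exp (-t) ^ n * \<phi> t)" for n
    by (rule Bochner_Integration.integrable_bound[OF \<phi>]) (use bnd in auto)
  have pow0: "(LBINT t. exp (-t) ^ n * \<phi> t) = 0" for n
  proof -
    have "(LBINT t. exp (-t) ^ n * \<phi> t) = (LBINT t:{0<..}. exp (- real (Suc n) * t) * g t)"
      unfolding set_lebesgue_integral_def \<phi>_def
      by (intro Bochner_Integration.integral_cong refl)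
         (auto simp: indicator_def algebra_simps exp_diff exp_minus exp_of_nat_mult exp_of_nat2_mult power_inverse divide_simps exp_add)
    then show ?thesis using zero by simp
  qed
  have poly0: "(LBINT t. p (exp (-t)) * \<phi> t) = 0"
    and polyint: "integrable lborel (\<lambda>t. p (exp (-t)) * \<phi> t)"
    if p: "real_polynomial_function p" for p
  proof -
    from p obtain a n where p: "p = (\<lambda>x. \<Sum>i\<le>n. a i * x ^ i)"
      by (auto simp: real_polynomial_function_iff_sum)
    show "integrable lborel (\<lambda>t. p (exp (-t)) * \<phi> t)"
      unfolding p sum_distrib_right mult.assoc
      using powint by (intro Bochner_Integration.integrable_sum) auto
    have "(LBINT t. p (exp (-t)) * \<phi> t) = (\<Sum>i\<le>n. a i * (LBINT t. exp (-t) ^ i * \<phi> t))"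
      unfolding p sum_distrib_right mult.assoc
      using powint by (subst Bochner_Integration.integral_sum) auto
    then show "(LBINT t. p (exp (-t)) * \<phi> t) = 0" by (simp add: pow0)
  qed
  define \<psi> where "\<psi> x = max 0 ((x - exp (- d)) * (exp (- c) - x))" for x :: real
  have \<psi>_cont: "continuous_on S \<psi>" for S unfolding \<psi>_def by (intro continuous_intros)
  have [measurable]: "\<psi> \<in> borel_measurable borel" using \<psi>_cont by (rule borel_measurable_continuous_onI)
  have \<psi>_nonneg: "0 \<le> \<psi> x" for x by (simp add: \<psi>_def)
  have \<psi>_pos: "0 < \<psi> (exp (- t)) \<longleftrightarrow> c < t \<and> t < d" for t
    using cd by (auto simp: \<psi>_def less_max_iff_disj zero_less_mult_iff)
  have \<psi>_bd: "\<bar>\<psi> x\<bar> \<le> 1" if "x \<in> {0..1}" for x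
  proof -
    have "exp (-c) \<le> 1" using cd by simp
    have "(x - exp (- d)) * (exp (- c) - x) \<le> 1"
    proof (cases "exp (- d) \<le> x \<and> x \<le> exp (- c)")
      case True
      moreover have "x - exp (- d) \<le> 1" "exp (- c) - x \<le> 1"
        using that exp_gt_zero[of "- d"] \<open>exp (-c) \<le> 1\<close> by (auto simp del: exp_gt_zero exp_le_one_iff)
      ultimately show ?thesis by (intro mult_le_one) auto
    next
      case False
      have "exp (- d) < exp (- c)" using cd by simp
      with False have "(x - exp (- d)) * (exp (- c) - x) \<le> 0"
        unfolding mult_le_0_iff by linarith
      then show ?thesis by simp
    qed
    then show ?thesis using \<psi>_nonneg[of x] by (auto simp: \<psi>_def)
  qed
  have on01: "exp (-t) \<in> {0..1}" if "\<phi> t \<noteq> 0" for t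
    using that by (auto simp: \<phi>_def indicator_def split: if_splits)
  have \<psi>int: "integrable lborel (\<lambda>t. \<psi> (exp (-t)) * \<phi> t)"
  proof (rule Bochner_Integration.integrable_bound[OF \<phi>])
    have "\<bar>\<psi> (exp (-t)) * \<phi> t\<bar> \<le> \<bar>\<phi> t\<bar>" for t
      using \<psi>_bd[OF on01] by (cases "\<phi> t = 0") (auto simp: abs_mult mult_left_le_one_le)
    then show "AE t in lborel. norm (\<psi> (exp (-t)) * \<phi> t) \<le> norm (\<phi> t)" by simp
  qed measurable
  define B where "B = (LBINT t. \<bar>\<phi> t\<bar>)"
  have B: "0 \<le> B" by (simp add: B_def)
  have small: "\<bar>LBINT t. \<psi> (exp (-t)) * \<phi> t\<bar> \<le> e * B" if e: "0 < e" for e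
  proof -
    obtain p where p: "real_polynomial_function p" "\<And>x. x \<in> {0..1} \<Longrightarrow> \<bar>\<psi> x - p x\<bar> < e"
      using Stone_Weierstrass_real_polynomial_function[OF compact_Icc \<psi>_cont e] by blast
    have "(LBINT t. \<psi> (exp (-t)) * \<phi> t) = (LBINT t. \<psi> (exp (-t)) * \<phi> t) - (LBINT t. p (exp (-t)) * \<phi> t)"
      using poly0[OF p(1)] by simp
    also have "\<dots> = (LBINT t. (\<psi> (exp (-t)) - p (exp (-t))) * \<phi> t)"
      using \<psi>int polyint[OF p(1)] by (simp add: left_diff_distrib)
    also have "\<bar>\<dots>\<bar> \<le> (LBINT t. e * \<bar>\<phi> t\<bar>)"
    proof -
      have "norm (LBINT t. (\<psi> (exp (-t)) - p (exp (-t))) * \<phi> t) \<le> (LBINT t. e * \<bar>\<phi> t\<bar>)"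
      proof (rule Bochner_Integration.integral_norm_bound_integral)
        show "integrable lborel (\<lambda>t. (\<psi> (exp (-t)) - p (exp (-t))) * \<phi> t)"
          using \<psi>int polyint[OF p(1)] by (simp add: left_diff_distrib)
        show "integrable lborel (\<lambda>t. e * \<bar>\<phi> t\<bar>)" by simp
        show "norm ((\<psi> (exp (-t)) - p (exp (-t))) * \<phi> t) \<le> e * \<bar>\<phi> t\<bar>" for t
          using p(2)[OF on01, of t] by (cases "\<phi> t = 0") (auto simp: abs_mult intro!: mult_right_mono)
      qed
      then show ?thesis by simp
    qed
    finally show ?thesis by (simp add: B_def)
  qed
  have "\<bar>LBINT t. \<psi> (exp (-t)) * \<phi> t\<bar> \<le> 0 + e" if "0 < e" for e
  proof -
    have "e / (B + 1) * B \<le> e" using that B by (simp add: pos_divide_le_eq algebra_simps)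
    then show ?thesis using small[of "e / (B + 1)"] that B by simp
  qed
  then have "(LBINT t. \<psi> (exp (-t)) * \<phi> t) = 0"
    using field_le_epsilon[of "\<bar>LBINT t. \<psi> (exp (-t)) * \<phi> t\<bar>" 0] by auto
  moreover have nn: "0 \<le> \<psi> (exp (-t)) * \<phi> t" for t
  proof (cases "c < t \<and> t < d")
    case True
    then show ?thesis using pos[of t] \<psi>_nonneg by (auto simp: \<phi>_def indicator_def)
  next
    case False
    then have "\<psi> (exp (-t)) = 0" using \<psi>_pos[of t] \<psi>_nonneg[of "exp (-t)"] by linarith
    then show ?thesis by simp
  qed
  ultimately have "AE t in lborel. \<psi> (exp (-t)) * \<phi> t = 0"
    using integral_nonneg_eq_0_iff_AE[OF \<psi>int] by auto
  then have "AE t in lborel. t \<notin> {c<..<d}"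
  proof eventually_elim
    case (elim t)
    show ?case
    proof
      assume t: "t \<in> {c<..<d}"
      then have "0 < \<psi> (exp (-t))" using \<psi>_pos by simp
      moreover have "0 < \<phi> t" using t cd pos[of t] by (auto simp: \<phi>_def)
      ultimately show False using elim by simp
    qed
  qed
  then have "emeasure lborel {c<..<d} = 0"
    by (subst (asm) AE_iff_measurable[where N = "{c<..<d}"]) auto
  then show False using cd by (simp add: ennreal_eq_0_iff)
qed

section \<open>Recognising Sonine pairs by their Laplace transforms\<close>

lemma volterra_eq_nn_integral:
  fixes \<kappa> k :: "real \<Rightarrow> real"
  assumes [measurable]: "\<kappa> \<in> borel_measurable borel" "k \<in> borel_measurable borel"
    and nn: "\<And>t. 0 < t \<Longrightarrow> 0 \<le> \<kappa> t" "\<And>t. 0 < t \<Longrightarrow> 0 \<le> k t"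
  shows "volterra \<kappa> k t = enn2real (\<integral>\<^sup>+s. indicator {0<..<t} s * ennreal (\<kappa> (t - s) * k s) \<partial>lborel)"
proof -
  have "volterra \<kappa> k t = enn2real (\<integral>\<^sup>+s. ennreal (indicator {0<..<t} s * (\<kappa> (t - s) * k s)) \<partial>lborel)"
    unfolding volterra_def set_lebesgue_integral_def real_scaleR_def
    using nn by (intro integral_eq_nn_integral) (auto simp: indicator_def)
  also have "(\<integral>\<^sup>+s. ennreal (indicator {0<..<t} s * (\<kappa> (t - s) * k s)) \<partial>lborel)
      = (\<integral>\<^sup>+s. indicator {0<..<t} s * ennreal (\<kappa> (t - s) * k s) \<partial>lborel)"
    by (intro nn_integral_cong) (auto simp: indicator_def)
  finally show ?thesis .
qed

lemma laplace_transform_convolution: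
  fixes f g :: "real \<Rightarrow> real"
  assumes [measurable]: "f \<in> borel_measurable borel" "g \<in> borel_measurable borel"
    and nn: "\<And>t. 0 < t \<Longrightarrow> 0 \<le> f t" "\<And>t. 0 < t \<Longrightarrow> 0 \<le> g t"
  shows "(\<integral>\<^sup>+t. ennreal (exp (- z * t)) *
            (\<integral>\<^sup>+s. indicator {0<..<t} s * ennreal (f (t - s) * g s) \<partial>lborel) \<partial>lborel)
       = (\<integral>\<^sup>+t. indicator {0<..} t * ennreal (exp (- z * t) * f t) \<partial>lborel)
       * (\<integral>\<^sup>+t. indicator {0<..} t * ennreal (exp (- z * t) * g t) \<partial>lborel)"
    (is "?L = ?F * ?G")
proof -
  let ?f = "\<lambda>t. indicator {0<..} t * ennreal (exp (- z * t) * f t)"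
  let ?g = "\<lambda>t. indicator {0<..} t * ennreal (exp (- z * t) * g t)"
  have "?L = (\<integral>\<^sup>+t. (\<integral>\<^sup>+s. ?f (t - s) * ?g s \<partial>lborel) \<partial>lborel)"
  proof (intro nn_integral_cong, subst nn_integral_cmult[symmetric])
    fix t :: real
    show "(\<integral>\<^sup>+s. ennreal (exp (- z * t)) * (indicator {0<..<t} s * ennreal (f (t - s) * g s)) \<partial>lborel)
        = (\<integral>\<^sup>+s. ?f (t - s) * ?g s \<partial>lborel)"
    proof (intro nn_integral_cong)
      fix s :: real
      have "exp (- z * t) * (f (t - s) * g s) = (exp (- z * (t - s)) * f (t - s)) * (exp (- z * s) * g s)"
        by (simp add: algebra_simps flip: exp_add)
      then show "ennreal (exp (- z * t)) * (indicator {0<..<t} s * ennreal (f (t - s) * g s)) = ?f (t - s) * ?g s"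
        using nn(1)[of "t - s"] nn(2)[of s] by (auto simp: indicator_def simp flip: ennreal_mult)
    qed
  qed measurable
  also have "\<dots> = (\<integral>\<^sup>+s. (\<integral>\<^sup>+t. ?f (t - s) * ?g s \<partial>lborel) \<partial>lborel)"
    by (intro lborel_pair.Fubini') measurable
  also have "\<dots> = (\<integral>\<^sup>+s. ?F * ?g s \<partial>lborel)"
  proof (intro nn_integral_cong)
    fix s :: real
    have "(\<integral>\<^sup>+t. ?f (t - s) * ?g s \<partial>lborel) = (\<integral>\<^sup>+t. ?f (t - s) \<partial>lborel) * ?g s"
      by (intro nn_integral_multc) measurable
    also have "(\<integral>\<^sup>+t. ?f (t - s) \<partial>lborel) = ?F"
      using nn_integral_real_affine[of ?f 1 "-s"] by simp
    finally show "(\<integral>\<^sup>+t. ?f (t - s) * ?g s \<partial>lborel) = ?F * ?g s" .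
  qed
  also have "\<dots> = ?F * ?G" by (intro nn_integral_cmult) measurable
  finally show ?thesis .
qed

lemma nn_integral_exp_Ioi:
  assumes "0 < (z::real)"
  shows "(\<integral>\<^sup>+t. indicator {0<..} t * ennreal (exp (- z * t)) \<partial>lborel) = ennreal (1 / z)"
proof -
  have "(\<integral>\<^sup>+t. indicator {0<..} t * ennreal (exp (- z * t)) \<partial>lborel)
      = (\<integral>\<^sup>+t. ennreal (exp (- z * t)) * indicator {0..} t \<partial>lborel)"
  proof (rule nn_integral_cong_AE)
    show "AE t in lborel. indicator {0<..} t * ennreal (exp (- z * t)) = ennreal (exp (- z * t)) * indicator {0..} t"
      using AE_lborel_singleton[of 0] by eventually_elim (auto simp: indicator_def)
  qed
  also have "\<dots> = ennreal (0 - (- exp (- z * 0) / z))"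
  proof (rule nn_integral_FTC_atLeast)
    show "((\<lambda>t. - exp (- z * t) / z) has_real_derivative exp (- z * t)) (at t)" for t
      using assms by (auto intro!: derivative_eq_intros)
    show "((\<lambda>t. - exp (- z * t) / z) \<longlongrightarrow> 0) at_top"
      using assms by - real_asymp
  qed auto
  finally show ?thesis by simp
qed

text \<open>Laplace transforms determine the convolution \<open>H\<close> only almost everywhere.  Monotonicity of the kernels
  upgrades this to every point: after the substitution \<open>s = t u\<close> one sees that \<open>H t / t\<close> is
  nonincreasing, so a deviation from 1 at one point forces a deviation of the same sign on an
  interval on one side of it.\<close>
lemma volterra_eq_1_if_laplace:
  fixes \<kappa> k :: "real \<Rightarrow> real"
  assumes meas[measurable]: "\<kappa> \<in> borel_measurable borel" "k \<in> borel_measurable borel"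
    and nn: "\<And>t. 0 < t \<Longrightarrow> 0 \<le> \<kappa> t" "\<And>t. 0 < t \<Longrightarrow> 0 \<le> k t"
    and anti: "\<And>s t. 0 < s \<Longrightarrow> s \<le> t \<Longrightarrow> \<kappa> t \<le> \<kappa> s" "\<And>s t. 0 < s \<Longrightarrow> s \<le> t \<Longrightarrow> k t \<le> k s"
    and lap: "\<And>z. 0 < z \<Longrightarrow>
      (\<integral>\<^sup>+t. indicator {0<..} t * ennreal (exp (- z * t) * \<kappa> t) \<partial>lborel)
      * (\<integral>\<^sup>+t. indicator {0<..} t * ennreal (exp (- z * t) * k t) \<partial>lborel) = ennreal (1 / z)"
    and t: "0 < t"
  shows "volterra \<kappa> k t = 1"
proof -
  define H where "H t = (\<integral>\<^sup>+s. indicator {0<..<t} s * ennreal (\<kappa> (t - s) * k s) \<partial>lborel)" for t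
  have Hmeas[measurable]: "H \<in> borel_measurable lborel"
  proof -
    have "H = (\<lambda>t. \<integral>\<^sup>+s. (if 0 < s \<and> s < t then ennreal (\<kappa> (t - s) * k s) else 0) \<partial>lborel)"
      unfolding H_def by (intro ext nn_integral_cong) (auto simp: indicator_def)
    also have "\<dots> \<in> borel_measurable lborel" by measurable
    finally show ?thesis .
  qed
  have scale: "ennreal s * H t \<le> ennreal t * H s" if st: "0 < s" "s \<le> t" for s t
  proof -
    have unit: "H r = ennreal r * (\<integral>\<^sup>+u. indicator {0<..<1} u * ennreal (\<kappa> (r * (1 - u)) * k (r * u)) \<partial>lborel)"
      if "0 < r" for r
    proof -
      have [measurable]: "(\<lambda>s. indicator {0<..<r} s * ennreal (\<kappa> (r - s) * k s)) \<in> borel_measurable borel"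
        by measurable
      have "H r = ennreal r * (\<integral>\<^sup>+u. indicator {0<..<r} (0 + r * u) * ennreal (\<kappa> (r - (0 + r * u)) * k (0 + r * u)) \<partial>lborel)"
        unfolding H_def using that by (subst nn_integral_real_affine[where c = r and t = 0]) auto
      also have "(\<integral>\<^sup>+u. indicator {0<..<r} (0 + r * u) * ennreal (\<kappa> (r - (0 + r * u)) * k (0 + r * u)) \<partial>lborel)
          = (\<integral>\<^sup>+u. indicator {0<..<1} u * ennreal (\<kappa> (r * (1 - u)) * k (r * u)) \<partial>lborel)"
        using that by (intro nn_integral_cong) (auto simp: indicator_def zero_less_mult_iff algebra_simps)
      finally show ?thesis .
    qed
    have "(\<integral>\<^sup>+u. indicator {0<..<1} u * ennreal (\<kappa> (t * (1 - u)) * k (t * u)) \<partial>lborel)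
        \<le> (\<integral>\<^sup>+u. indicator {0<..<1} u * ennreal (\<kappa> (s * (1 - u)) * k (s * u)) \<partial>lborel)"
    proof (intro nn_integral_mono)
      fix u :: real
      show "indicator {0<..<1} u * ennreal (\<kappa> (t * (1 - u)) * k (t * u))
          \<le> indicator {0<..<1} u * ennreal (\<kappa> (s * (1 - u)) * k (s * u))"
        using st by (auto simp: indicator_def intro!: ennreal_leI mult_mono anti nn mult_right_mono)
    qed
    then show ?thesis
      using st by (simp add: unit mult_ac mult_left_mono)
  qed
  have lapH: "(\<integral>\<^sup>+t. ennreal (exp (- z * t)) * H t \<partial>lborel) = ennreal (1 / z)" if "0 < z" for z
    unfolding H_def using laplace_transform_convolution[OF meas nn] lap[OF that] by simp
  have fin: "H t < top" if t: "0 < t" for t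
  proof (rule ccontr)
    assume "\<not> H t < top"
    then have "H t = top" by (simp add: less_top[symmetric])
    then have inf: "H s = top" if "0 < s" "s < t" for s
      using scale[of s t] that t by (auto simp: ennreal_mult_top ennreal_top_mult ennreal_mult_eq_top_iff top_unique)
    have "AE r in lborel. ennreal (exp (- 1 * r)) * H r \<noteq> \<infinity>"
      using lapH[of 1] by (intro nn_integral_PInf_AE) auto
    then have "AE r in lborel. r \<notin> {0<..<t}"
      by eventually_elim (use inf in \<open>auto simp: ennreal_mult_top\<close>)
    then have "emeasure lborel {0<..<t} = 0"
      by (subst (asm) AE_iff_measurable[where N = "{0<..<t}"]) auto
    then show False using t by simp
  qed
  define h where "h t = enn2real (H t)" for t
  have h: "H t = ennreal (h t)" if "0 < t" for t
    using fin[OF that] by (simp add: h_def)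
  have h_nonneg: "0 \<le> h t" for t by (simp add: h_def)
  have [measurable]: "h \<in> borel_measurable lborel" unfolding h_def by measurable
  have hscale: "s * h t \<le> t * h s" if "0 < s" "s \<le> t" for s t
    using scale[OF that] that h_nonneg by (simp add: h flip: ennreal_mult)
  have laph: "(\<integral>\<^sup>+t. ennreal (indicator {0<..} t * (exp (- z * t) * h t)) \<partial>lborel) = ennreal (1 / z)"
    if "0 < z" for z
  proof -
    have "(\<integral>\<^sup>+t. ennreal (indicator {0<..} t * (exp (- z * t) * h t)) \<partial>lborel)
        = (\<integral>\<^sup>+t. ennreal (exp (- z * t)) * H t \<partial>lborel)"
    proof (intro nn_integral_cong)
      fix t :: real
      show "ennreal (indicator {0<..} t * (exp (- z * t) * h t)) = ennreal (exp (- z * t)) * H t"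
      proof (cases "0 < t")
        case False
        then have "H t = 0" by (simp add: H_def)
        then show ?thesis using False by simp
      qed (simp add: h h_nonneg ennreal_mult)
    qed
    then show ?thesis using lapH[OF that] by simp
  qed
  have laph_int: "set_integrable lborel {0<..} (\<lambda>t. exp (- z * t) * h t)"
    and laph_eq: "(LBINT t:{0<..}. exp (- z * t) * h t) = 1 / z" if "0 < z" for z
    unfolding set_integrable_def set_lebesgue_integral_def real_scaleR_def
    using laph[OF that] that h_nonneg
    by (auto intro!: integrableI_nonneg simp: integral_eq_nn_integral)
  have lap1: "(\<integral>\<^sup>+t. ennreal (indicator {0<..} t * exp (- z * t)) \<partial>lborel) = ennreal (1 / z)" if "0 < z" for z :: real
  proof -
    have "(\<integral>\<^sup>+t. ennreal (indicator {0<..} t * exp (- z * t)) \<partial>lborel) = (\<integral>\<^sup>+t. indicator {0<..} t * ennreal (exp (- z * t)) \<partial>lborel)"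
      by (intro nn_integral_cong) (auto simp: indicator_def)
    then show ?thesis using nn_integral_exp_Ioi[OF that] by simp
  qed
  have lap1_int: "set_integrable lborel {0<..} (\<lambda>t. exp (- z * t))"
    and lap1_eq: "(LBINT t:{0<..}. exp (- z * t)) = 1 / z" if "0 < z" for z :: real
    unfolding set_integrable_def set_lebesgue_integral_def real_scaleR_def
    using lap1[OF that] that
    by (auto intro!: integrableI_nonneg simp: integral_eq_nn_integral)
  have int: "set_integrable lborel {0<..} (\<lambda>t. exp (- z * t) * (h t - 1))"
    and eq: "(LBINT t:{0<..}. exp (- z * t) * (h t - 1)) = 0"
    and int': "set_integrable lborel {0<..} (\<lambda>t. exp (- z * t) * (1 - h t))"
    and eq': "(LBINT t:{0<..}. exp (- z * t) * (1 - h t)) = 0"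
    if "0 < z" for z
    using set_integral_diff[OF laph_int[OF that] lap1_int[OF that]]
      set_integral_diff[OF lap1_int[OF that] laph_int[OF that]] laph_eq[OF that] lap1_eq[OF that]
    by (auto simp: right_diff_distrib)
  have "h t = 1"
  proof (rule ccontr)
    assume "h t \<noteq> 1"
    then consider "1 < h t" | "h t < 1" by linarith
    then show False
    proof cases
      case 1
      \<comment> \<open>\<open>h s \<ge> s h t / t\<close> to the left of \<open>t\<close>, which exceeds 1 as long as \<open>s > c\<close>.\<close>
      define c where "c = t / h t"
      have c: "0 < c" "c < t" using t 1 by (auto simp: c_def field_simps)
      have "0 < h s - 1" if "c < s" "s < t" for s
      proof -
        have "t < s * h t" using that 1 by (simp add: c_def field_simps)
        also have "\<dots> \<le> t * h s" using hscale[of s t] c that by simp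
        finally show ?thesis using t by simp
      qed
      then show False
        using zero_laplace_not_positive_on_interval[of "\<lambda>t. h t - 1" c t] int[of 1] eq[of "real (Suc n)" for n] c
        by auto
    next
      case 2
      \<comment> \<open>\<open>h s \<le> s h t / t\<close> to the right of \<open>t\<close>, which is below 1 as long as \<open>s < d\<close>; if \<open>h t = 0\<close>
        it is so everywhere.\<close>
      define d where "d = (if h t = 0 then 2 * t else t / h t)"
      have d: "t < d" using t 2 h_nonneg[of t] by (auto simp: d_def field_simps)
      have "0 < 1 - h s" if "t < s" "s < d" for s
      proof -
        have "t * h s \<le> s * h t" using hscale[of t s] t that by simp
        also have "\<dots> < t" using that 2 h_nonneg[of t] t by (auto simp: d_def field_simps split: if_splits)
        finally show ?thesis using t by simp
      qed
      then show False
        using zero_laplace_not_positive_on_interval[of "\<lambda>t. 1 - h t" t d] d t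
          int'[of 1] eq'[of "real (Suc n)" for n] by auto
    qed
  qed
  then show ?thesis
    using volterra_eq_nn_integral[OF meas nn] by (simp add: h_def H_def)
qed

section \<open>Injectivity of the Volterra operator of a Sonine kernel\<close>

text \<open>The Sonine identity, translated to \<open>{r<..<t}\<close>; integrability is forced by the nonzero
  value of the integral.\<close>
lemma sonine_pair_kernel_integral:
  fixes \<kappa> k :: "real \<Rightarrow> real"
  assumes son: "sonine_pair_on {0<..} \<kappa> k" and rt: "r < t"
  shows "integrable lborel (\<lambda>s. if r < s \<and> s < t then k (t - s) * \<kappa> (s - r) else 0)" (is "integrable _ ?f")
    and "(LBINT s. if r < s \<and> s < t then k (t - s) * \<kappa> (s - r) else 0) = 1"
proof -
  have 1: "(LBINT s. indicator {0<..<t - r} s * (\<kappa> (t - r - s) * k s)) = 1"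
    using son rt by (simp add: sonine_pair_on_def volterra_def set_lebesgue_integral_def)
  have shift: "(\<lambda>s. indicator {0<..<t - r} (t + (-1) * s) * (\<kappa> (t - r - (t + (-1) * s)) * k (t + (-1) * s))) = ?f"
    by (auto simp: fun_eq_iff indicator_def algebra_simps)
  have "integrable lborel (\<lambda>s. indicator {0<..<t - r} s * (\<kappa> (t - r - s) * k s))"
    using 1 not_integrable_integral_eq by fastforce
  from lborel_integrable_real_affine[OF this, of "-1" t] shift show "integrable lborel ?f" by simp
  show "(LBINT s. ?f s) = 1"
    using 1 shift by (subst (asm) lborel_integral_real_affine[where c = "-1" and t = t]) auto
qed

text \<open>By Fubini, \<open>k * (\<kappa> * f) = (k * \<kappa>) * f = 1 * f\<close>.\<close>
lemma volterra_volterra_if_sonine: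
  fixes \<kappa> k :: "real \<Rightarrow> real" and f :: "real \<Rightarrow> 'b::{banach,second_countable_topology}"
  assumes [measurable]: "\<kappa> \<in> borel_measurable borel" "k \<in> borel_measurable borel"
    and nn: "\<And>t. 0 < t \<Longrightarrow> 0 \<le> \<kappa> t" "\<And>t. 0 < t \<Longrightarrow> 0 \<le> k t"
    and son: "sonine_pair_on {0<..} \<kappa> k"
    and cont: "continuous_on {0..t} f"
  shows "volterra k (volterra \<kappa> f) t = (LBINT r:{0<..<t}. f r)"
proof -
  define f0 where "f0 r = indicator {0..t} r *\<^sub>R f r" for r
  have f0_int: "integrable lborel f0"
    using borel_integrable_atLeastAtMost'[OF cont] by (simp add: f0_def[abs_def] set_integrable_def)
  have [measurable]: "f0 \<in> borel_measurable borel"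
    using borel_measurable_integrable[OF f0_int] by simp
  \<comment> \<open>The integrand on the triangle \<open>0 < r < s < t\<close>, extended by zero.\<close>
  define F where "F r s = (if 0 < r \<and> r < s \<and> s < t then (k (t - s) * \<kappa> (s - r)) *\<^sub>R f0 r else 0)" for r s
  have F_eq: "F r = (\<lambda>s. (if r < s \<and> s < t then k (t - s) * \<kappa> (s - r) else 0) *\<^sub>R (indicator {0<..<t} r *\<^sub>R f0 r))" for r
    by (auto simp: fun_eq_iff F_def)
  have F_norm: "norm (F r s) = (if r < s \<and> s < t then k (t - s) * \<kappa> (s - r) else 0) * norm (indicator {0<..<t} r *\<^sub>R f0 r)" for r s
    using nn(1)[of "s - r"] nn(2)[of "t - s"] by (auto simp: F_eq abs_mult)
  have inner: "integrable lborel (F r)"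
    "(LBINT s. F r s) = indicator {0<..<t} r *\<^sub>R f0 r"
    "(LBINT s. norm (F r s)) = norm (indicator {0<..<t} r *\<^sub>R f0 r)" for r
  proof -
    consider "r < t" | "t \<le> r" by linarith
    then have "integrable lborel (F r) \<and> (LBINT s. F r s) = indicator {0<..<t} r *\<^sub>R f0 r
       \<and> (LBINT s. norm (F r s)) = norm (indicator {0<..<t} r *\<^sub>R f0 r)"
    proof cases
      case 1
      show ?thesis unfolding F_norm unfolding F_eq
        using sonine_pair_kernel_integral[OF son 1] by simp
    next
      case 2
      then have "F r = (\<lambda>s. 0)" by (auto simp: F_def fun_eq_iff)
      then show ?thesis using 2 by simp
    qed
    then show "integrable lborel (F r)"
      "(LBINT s. F r s) = indicator {0<..<t} r *\<^sub>R f0 r"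
      "(LBINT s. norm (F r s)) = norm (indicator {0<..<t} r *\<^sub>R f0 r)" by auto
  qed
  have f0_int': "integrable lborel (\<lambda>r. indicator {0<..<t} r *\<^sub>R f0 r)"
    using f0_int by (intro integrable_mult_indicator) auto
  have "integrable (lborel \<Otimes>\<^sub>M lborel) (\<lambda>(r, s). F r s)"
  proof (rule lborel_pair.Fubini_integrable)
    show "(\<lambda>(r, s). F r s) \<in> borel_measurable (lborel \<Otimes>\<^sub>M lborel)"
      unfolding F_def by measurable
    show "integrable lborel (\<lambda>r. LBINT s. norm (case (r, s) of (r, s) \<Rightarrow> F r s))"
      using integrable_norm[OF f0_int'] by (simp only: inner prod.case)
  qed (use inner in simp)
  then have swap: "(LBINT s. (LBINT r. F r s)) = (LBINT r. (LBINT s. F r s))"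
    by (rule lborel_pair.Fubini_integral)
  have "(LBINT r. F r s) = indicator {0<..<t} s *\<^sub>R (k (t - s) *\<^sub>R volterra \<kappa> f s)" for s
  proof (cases "0 < s \<and> s < t")
    case True
    have "(LBINT r. F r s) = (LBINT r. k (t - s) *\<^sub>R (indicator {0<..<s} r *\<^sub>R (\<kappa> (s - r) *\<^sub>R f r)))"
      using True by (intro Bochner_Integration.integral_cong) (auto simp: F_def f0_def indicator_def)
    also have "\<dots> = k (t - s) *\<^sub>R volterra \<kappa> f s"
      unfolding volterra_def set_lebesgue_integral_def by (rule integral_scaleR_right)
    finally show ?thesis using True by simp
  next
    case False
    then have "F r s = 0" for r by (auto simp: F_def)
    then show ?thesis using False by simp
  qed
  then have "volterra k (volterra \<kappa> f) t = (LBINT s. (LBINT r. F r s))"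
    by (simp add: volterra_def[of k] set_lebesgue_integral_def)
  also have "\<dots> = (LBINT r:{0<..<t}. f r)"
    unfolding swap inner set_lebesgue_integral_def
    by (intro Bochner_Integration.integral_cong) (auto simp: f0_def indicator_def)
  finally show ?thesis .
qed

lemma volterra_inj_if_sonine:
  fixes \<kappa> k :: "real \<Rightarrow> real"
  assumes meas: "\<kappa> \<in> borel_measurable borel" "k \<in> borel_measurable borel"
    and nn: "\<And>t. 0 < t \<Longrightarrow> 0 \<le> \<kappa> t" "\<And>t. 0 < t \<Longrightarrow> 0 \<le> k t"
    and son: "sonine_pair_on {0<..} \<kappa> k" and T: "0 < T"
  shows "volterra_inj_on_C TYPE('b::euclidean_space) T \<kappa>"
  unfolding volterra_inj_on_C_def
proof (intro allI impI ballI)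
  fix f g :: "real \<Rightarrow> 'b" and t
  assume cont: "continuous_on {0..T} f" "continuous_on {0..T} g"
    and eq: "\<forall>t\<in>{0..T}. volterra \<kappa> f t = volterra \<kappa> g t" and t: "t \<in> {0..T}"
  have prim: "integral {0..s} f = volterra k (volterra \<kappa> f) s"
    if "s \<in> {0..T}" "continuous_on {0..T} f" for s and f :: "real \<Rightarrow> 'b"
  proof -
    have c: "continuous_on {0..s} f" using that by (auto intro: continuous_on_subset)
    have "volterra k (volterra \<kappa> f) s = (LBINT r:{0<..<s}. f r)"
      using meas nn son c by (rule volterra_volterra_if_sonine)
    also have "\<dots> = (LBINT r:{0..s}. f r)"
      unfolding set_lebesgue_integral_def
    proof (rule integral_cong_AE)
      show m: "(\<lambda>r. indicator {0..s} r *\<^sub>R f r) \<in> borel_measurable lborel"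
        using borel_integrable_atLeastAtMost'[OF c] unfolding set_integrable_def
        by (rule borel_measurable_integrable)
      have "(\<lambda>r. indicator {0<..<s} r *\<^sub>R (indicator {0..s} r *\<^sub>R f r)) \<in> borel_measurable lborel"
        by (intro borel_measurable_scaleR m) auto
      also have "(\<lambda>r. indicator {0<..<s} r *\<^sub>R (indicator {0..s} r *\<^sub>R f r)) = (\<lambda>r. indicator {0<..<s} r *\<^sub>R f r)"
        by (auto simp: indicator_def)
      finally show "(\<lambda>r. indicator {0<..<s} r *\<^sub>R f r) \<in> borel_measurable lborel" .
      show "AE r in lborel. indicator {0<..<s} r *\<^sub>R f r = indicator {0..s} r *\<^sub>R f r"
        using AE_lborel_singleton[of 0] AE_lborel_singleton[of s]
        by eventually_elim (auto simp: indicator_def)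
    qed
    also have "\<dots> = integral {0..s} f"
      by (rule set_borel_integral_eq_integral(2)[OF borel_integrable_atLeastAtMost'[OF c]])
    finally show ?thesis ..
  qed
  have "volterra k (volterra \<kappa> f) s = volterra k (volterra \<kappa> g) s" if "s \<in> {0..T}" for s
    unfolding volterra_def[of k] using eq that
    by (intro set_lebesgue_integral_cong) auto
  then have same: "integral {0..s} f = integral {0..s} g" if "s \<in> {0..T}" for s
    using prim that cont by simp
  have "((\<lambda>u. integral {0..u} f) has_vector_derivative f t) (at t within {0..T})"
    using integral_has_vector_derivative[OF cont(1) t] .
  then have "((\<lambda>u. integral {0..u} g) has_vector_derivative f t) (at t within {0..T})"
    by (rule has_vector_derivative_transform[OF t, rotated]) (simp add: same)
  moreover have "((\<lambda>u. integral {0..u} g) has_vector_derivative g t) (at t within {0..T})"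
    using integral_has_vector_derivative[OF cont(2) t] .
  ultimately show "f t = g t"
    using vector_derivative_unique_within_closed_interval[of 0 T t] T t by auto
qed

section \<open>Residue calculus in a strip\<close>

lemma contour_integral_linepath_same_Im:
  assumes "a < b"
  shows "contour_integral (linepath (Complex a c) (Complex b c)) f = integral {a..b} (\<lambda>x. f (Complex x c))"
proof -
  have "contour_integral (linepath (Complex a c) (Complex b c)) f =
      of_real (b - a) * integral {0..1} (\<lambda>x. f (linepath (Complex a c) (Complex b c) x))"
    by (simp add: contour_integral_integral) (simp add: Complex_eq algebra_simps)
  also have "(\<lambda>x. f (linepath (Complex a c) (Complex b c) x)) = (\<lambda>x. f (Complex ((b - a) * x + a) c))"
    by (simp add: linepath_def Complex_eq scaleR_conv_of_real algebra_simps)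
  also have "integral {0..1} (\<lambda>x. f (Complex ((b - a) * x + a) c)) = integral {a..b} (\<lambda>x. f (Complex x c)) / of_real (b - a)"
  proof -
    have "integral {0..1} (\<lambda>x. f (Complex ((b - a) * x + a) c)) =
        integral ((\<lambda>x. x / (b - a)) ` {0..b - a}) (\<lambda>x. f (Complex ((b - a) * x + a) c))"
      using assms by simp
    also have "\<dots> = integral {a - a..b - a} (\<lambda>x. f (Complex (x + a) c)) / of_real (b - a)"
      using assms by (subst integral_stretch_real) (auto simp: scaleR_conv_of_real)
    also have "\<dots> = integral {a..b} (\<lambda>x. f (Complex x c)) / of_real (b - a)"
      by (subst integral_shift_real_ivl) (rule refl)
    finally show ?thesis .
  qed
  finally show ?thesis using assms by simp
qed

text \<open>The residue theorem for \<open>G \<zeta> exp \<zeta> / (exp \<zeta> - z)\<close> on the rectangle \<open>[-R, R] \<times> [-pi, pi]\<close>.  This is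
  Cauchy's formula for a function on the slit plane in logarithmic coordinates: the only pole in
  the strip is \<open>ln z\<close>, where the residue is \<open>G (ln z)\<close>, and on both horizontal sides \<open>exp \<zeta>\<close> equals \<open>- exp x\<close>,
  so that they combine to the integral of the jump of \<open>G\<close>.  The right-hand side of the
  estimate collects the two vertical sides.  The condition \<open>c < 2 * pi\<close> keeps the poles
  \<open>ln z \<plusminus> 2 pi \<i>\<close> out of the domain.\<close>
lemma strip_residue_estimate:
  fixes G :: "complex \<Rightarrow> complex"
  assumes G: "G holomorphic_on {\<zeta>. \<bar>Im \<zeta>\<bar> < c}" and c: "pi < c" "c < 2 * pi"
    and z: "0 < z" and R: "\<bar>ln z\<bar> < R"
    and B1: "\<And>y. \<bar>y\<bar> \<le> pi \<Longrightarrow> norm (G (Complex R y)) \<le> B1"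
    and B2: "\<And>y. \<bar>y\<bar> \<le> pi \<Longrightarrow> norm (G (Complex (-R) y)) \<le> B2"
  shows "norm (integral {-R..R} (\<lambda>x. (G (Complex x (-pi)) - G (Complex x pi)) * of_real (exp x / (exp x + z)))
      - 2 * of_real pi * \<i> * G (of_real (ln z)))
    \<le> 2 * pi * (B1 * (exp R / (exp R - z)) + B2 * (exp (-R) / (z - exp (-R))))"
proof -
  define S where "S = {\<zeta>. \<bar>Im \<zeta>\<bar> < c}"
  have S_eq: "S = {\<zeta>. Im \<zeta> < c} \<inter> {\<zeta>. Im \<zeta> > - c}" by (auto simp: S_def)
  have S: "open S" "convex S"
    unfolding S_eq by (auto intro!: open_Int convex_Int open_halfspace_Im_lt open_halfspace_Im_gt
      convex_halfspace_Im_lt convex_halfspace_Im_gt)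
  define \<zeta>0 where "\<zeta>0 = complex_of_real (ln z)"
  have exp0: "exp \<zeta>0 = of_real z" using z by (simp add: \<zeta>0_def exp_of_real)
  have \<zeta>0: "\<zeta>0 \<in> S" using c pi_gt_zero by (simp add: S_def \<zeta>0_def)
  have pole: "exp \<zeta> = of_real z \<longleftrightarrow> \<zeta> = \<zeta>0" if "\<zeta> \<in> S" for \<zeta>
  proof
    assume "exp \<zeta> = of_real z"
    then have "exp \<zeta> = exp \<zeta>0" by (simp add: exp0)
    then obtain n :: int where n: "\<zeta> = \<zeta>0 + (of_int (2 * n) * pi) * \<i>" by (auto simp: exp_eq)
    then have "Im \<zeta> = of_int (2 * n) * pi" by (simp add: \<zeta>0_def)
    with that c have "\<bar>of_int (2 * n) * pi\<bar> < 2 * pi" by (simp add: S_def)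
    then have "\<bar>real_of_int n\<bar> < 1" by (simp add: abs_mult)
    then have "n = 0" by linarith
    then show "\<zeta> = \<zeta>0" using n by simp
  qed (simp add: exp0)
  define f where "f \<zeta> = (G \<zeta> * exp \<zeta>) / (exp \<zeta> - of_real z)" for \<zeta>
  have f_hol: "f holomorphic_on S - {\<zeta>0}"
    unfolding f_def using G pole by (intro holomorphic_intros) (auto simp: S_def[symmetric] intro: holomorphic_on_subset)
  have res: "residue f \<zeta>0 = G \<zeta>0"
  proof (rule residue_simple'[OF \<open>open S\<close> \<zeta>0 f_hol])
    have "((\<lambda>\<zeta>. exp \<zeta> - of_real z) has_field_derivative exp \<zeta>0) (at \<zeta>0)"
      by (auto intro!: derivative_eq_intros)
    then have "((\<lambda>\<zeta>. (exp \<zeta> - of_real z) / (\<zeta> - \<zeta>0)) \<longlongrightarrow> exp \<zeta>0) (at \<zeta>0)"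
      by (simp add: has_field_derivative_iff exp0)
    moreover have "((\<lambda>\<zeta>. G \<zeta> * exp \<zeta>) \<longlongrightarrow> G \<zeta>0 * exp \<zeta>0) (at \<zeta>0)"
    proof -
      have "(\<lambda>\<zeta>. G \<zeta> * exp \<zeta>) holomorphic_on S" using G by (intro holomorphic_intros) (simp add: S_def)
      then have "isCont (\<lambda>\<zeta>. G \<zeta> * exp \<zeta>) \<zeta>0"
        using S(1) \<zeta>0 continuous_on_eq_continuous_at holomorphic_on_imp_continuous_on by blast
      then show ?thesis by (simp add: isCont_def)
    qed
    ultimately have "((\<lambda>\<zeta>. G \<zeta> * exp \<zeta> / ((exp \<zeta> - of_real z) / (\<zeta> - \<zeta>0))) \<longlongrightarrow> G \<zeta>0 * exp \<zeta>0 / exp \<zeta>0) (at \<zeta>0)"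
      by (intro tendsto_divide) auto
    then show "((\<lambda>\<zeta>. f \<zeta> * (\<zeta> - \<zeta>0)) \<longlongrightarrow> G \<zeta>0) (at \<zeta>0)"
      by (simp add: f_def mult_ac)
  qed
  define l where "l = Complex (-R) (-pi)"
  define u where "u = Complex R pi"
  have Rpos: "0 < R" using R by linarith
  have \<zeta>0_box: "\<zeta>0 \<in> box l u"
    using R pi_gt_zero by (auto simp: in_box_complex_iff \<zeta>0_def l_def u_def)
  have img: "path_image (rectpath l u) \<subseteq> S - {\<zeta>0}"
  proof -
    have "path_image (rectpath l u) \<subseteq> cbox l u" "path_image (rectpath l u) \<inter> box l u = {}"
      using Rpos pi_gt_zero
      by (intro path_image_rectpath_subset_cbox path_image_rectpath_inter_box; simp add: l_def u_def)+
    moreover have "cbox l u \<subseteq> S" using c by (auto simp: in_cbox_complex_iff l_def u_def S_def)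
    ultimately show ?thesis using \<zeta>0_box by blast
  qed
  have "contour_integral (rectpath l u) f = 2 * pi * \<i> * (\<Sum>p\<in>{\<zeta>0}. winding_number (rectpath l u) p * residue f p)"
  proof (rule Residue_theorem[of S])
    show "\<forall>w. w \<notin> S \<longrightarrow> winding_number (rectpath l u) w = 0"
      using img S by (auto intro!: winding_number_zero_outside[of _ S])
  qed (use S f_hol img convex_connected in auto)
  then have total: "contour_integral (rectpath l u) f = 2 * pi * \<i> * G \<zeta>0"
    using winding_number_rectpath[OF \<zeta>0_box] res by simp
  define l' where "l' = Complex R (-pi)"
  define u' where "u' = Complex (-R) pi"
  have cont: "continuous_on (closed_segment p q) f" if "closed_segment p q \<subseteq> S - {\<zeta>0}" for p q
    using f_hol that by (meson continuous_on_subset holomorphic_on_imp_continuous_on)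
  have rect: "rectpath l u = linepath l l' +++ linepath l' u +++ linepath u u' +++ linepath u' l"
    by (simp add: rectpath_def l_def u_def l'_def u'_def Let_def)
  have segs: "closed_segment l l' \<subseteq> S - {\<zeta>0}" "closed_segment l' u \<subseteq> S - {\<zeta>0}"
    "closed_segment u u' \<subseteq> S - {\<zeta>0}" "closed_segment u' l \<subseteq> S - {\<zeta>0}"
    using img unfolding rect by (auto simp: path_image_join)
  note ints = segs[THEN cont, THEN contour_integrable_continuous_linepath]
  have "contour_integral (rectpath l u) f = contour_integral (linepath l l') f + contour_integral (linepath l' u) f
      + contour_integral (linepath u u') f + contour_integral (linepath u' l) f"
    unfolding rect using ints by (simp add: valid_path_join)
  also have "contour_integral (linepath u u') f = - contour_integral (linepath u' u) f"
    by (intro contour_integral_reverse_linepath cont segs)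
  also have "contour_integral (linepath l l') f = integral {-R..R} (\<lambda>x. f (Complex x (-pi)))"
    unfolding l_def l'_def using Rpos by (intro contour_integral_linepath_same_Im) auto
  also have "contour_integral (linepath u' u) f = integral {-R..R} (\<lambda>x. f (Complex x pi))"
    unfolding u_def u'_def using Rpos by (intro contour_integral_linepath_same_Im) auto
  finally have split: "2 * pi * \<i> * G \<zeta>0 = integral {-R..R} (\<lambda>x. f (Complex x (-pi))) - integral {-R..R} (\<lambda>x. f (Complex x pi))
      + contour_integral (linepath l' u) f + contour_integral (linepath u' l) f"
    unfolding total by simp
  have conts: "continuous_on {-R..R} (\<lambda>x. G (Complex x y) * of_real (exp x / (exp x + z)))" if "\<bar>y\<bar> = pi" for y
  proof -
    have "continuous_on {-R..R} (\<lambda>x. G (Complex x y))"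
      by (rule continuous_on_compose2[OF holomorphic_on_imp_continuous_on[OF G]])
         (use that c in \<open>auto simp: Complex_eq intro!: continuous_intros\<close>)
    moreover have "exp x + z \<noteq> 0" for x using z by (simp add: add_pos_pos less_imp_neq[THEN not_sym])
    ultimately show ?thesis by (intro continuous_intros) auto
  qed
  have fpi: "f (Complex x y) = G (Complex x y) * of_real (exp x / (exp x + z))" if "\<bar>y\<bar> = pi" for x y
  proof -
    have "exp (Complex x y) = of_real (- exp x)"
    proof -
      from that have "y = pi \<or> y = - pi" by linarith
      then show ?thesis by (auto simp: complex_eq_iff Re_exp Im_exp)
    qed
    then have "exp (Complex x y) / (exp (Complex x y) - of_real z) = of_real (- exp x / (- exp x - z))"
      by simp
    also have "- exp x / (- exp x - z) = exp x / (exp x + z)"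
      using minus_divide_divide[of "exp x" "exp x + z"] by simp
    finally show ?thesis by (simp only: f_def flip: times_divide_eq_right)
  qed
  have main: "integral {-R..R} (\<lambda>x. f (Complex x (-pi))) - integral {-R..R} (\<lambda>x. f (Complex x pi))
      = integral {-R..R} (\<lambda>x. (G (Complex x (-pi)) - G (Complex x pi)) * of_real (exp x / (exp x + z)))"
    using conts[of pi] conts[of "-pi"]
    by (simp add: fpi left_diff_distrib integral_diff integrable_continuous_interval del: of_real_divide)
  have right: "norm (contour_integral (linepath l' u) f) \<le> (B1 * (exp R / (exp R - z))) * norm (u - l')"
  proof (rule contour_integral_bound_linepath[OF ints(2)])
    have ex: "z < exp R" using R z by (metis abs_less_iff exp_less_cancel_iff exp_ln)
    have "0 \<le> B1" using B1[of 0] norm_ge_zero order_trans pi_ge_zero by (metis abs_zero)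
    then show "0 \<le> B1 * (exp R / (exp R - z))" using ex by simp
    fix w assume "w \<in> closed_segment l' u"
    then have "Re w = R" "\<bar>Im w\<bar> \<le> pi"
      unfolding l'_def u_def by (auto simp: closed_segment_same_Re closed_segment_eq_real_ivl)
    then obtain y where w: "w = Complex R y" "\<bar>y\<bar> \<le> pi"
      by (metis complex.collapse)
    have "norm (f w) = norm (G w) * (exp R / norm (exp w - of_real z))"
      by (simp add: f_def norm_divide norm_mult w)
    also have "\<dots> \<le> B1 * (exp R / (exp R - z))"
    proof (intro mult_mono divide_left_mono)
      have "norm (exp w) - norm (of_real z :: complex) \<le> norm (exp w - of_real z)" by (rule norm_triangle_ineq2)
      then show le: "exp R - z \<le> norm (exp w - of_real z)" using z w by simp
      show "0 < norm (exp w - of_real z) * (exp R - z)" using le ex by (intro mult_pos_pos) linarith+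
    qed (use B1 w \<open>0 \<le> B1\<close> in auto)
    finally show "norm (f w) \<le> B1 * (exp R / (exp R - z))" .
  qed
  have left: "norm (contour_integral (linepath u' l) f) \<le> (B2 * (exp (-R) / (z - exp (-R)))) * norm (l - u')"
  proof (rule contour_integral_bound_linepath[OF ints(4)])
    have ex: "exp (-R) < z" using R z by (metis abs_less_iff exp_less_cancel_iff exp_ln minus_less_iff)
    have "0 \<le> B2" using B2[of 0] norm_ge_zero order_trans pi_ge_zero by (metis abs_zero)
    then show "0 \<le> B2 * (exp (-R) / (z - exp (-R)))" using ex by simp
    fix w assume "w \<in> closed_segment u' l"
    then have "w \<in> closed_segment l u'" by (simp add: closed_segment_commute)
    then have "Re w = -R" "\<bar>Im w\<bar> \<le> pi"
      unfolding l_def u'_def by (auto simp: closed_segment_same_Re closed_segment_eq_real_ivl)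
    then obtain y where w: "w = Complex (-R) y" "\<bar>y\<bar> \<le> pi"
      by (metis complex.collapse)
    have "norm (f w) = norm (G w) * (exp (-R) / norm (exp w - of_real z))"
      by (simp add: f_def norm_divide norm_mult w)
    also have "\<dots> \<le> B2 * (exp (-R) / (z - exp (-R)))"
    proof (intro mult_mono divide_left_mono)
      have "norm (of_real z :: complex) - norm (exp w) \<le> norm (of_real z - exp w)" by (rule norm_triangle_ineq2)
      then show le: "z - exp (-R) \<le> norm (exp w - of_real z)" using z w by (simp add: norm_minus_commute)
      show "0 < norm (exp w - of_real z) * (z - exp (-R))" using le ex by (intro mult_pos_pos) linarith+
    qed (use B2 w \<open>0 \<le> B2\<close> in auto)
    finally show "norm (f w) \<le> B2 * (exp (-R) / (z - exp (-R)))" .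
  qed
  have lens: "norm (u - l') = 2 * pi" "norm (l - u') = 2 * pi"
    by (auto simp: u_def l'_def l_def u'_def cmod_def real_sqrt_mult)
  have "norm (integral {-R..R} (\<lambda>x. (G (Complex x (-pi)) - G (Complex x pi)) * of_real (exp x / (exp x + z)))
      - 2 * of_real pi * \<i> * G \<zeta>0) = norm (contour_integral (linepath l' u) f + contour_integral (linepath u' l) f)"
  proof -
    have swap: "norm (v - t) = norm (p + q)" if "t = v + p + q" for t v p q :: complex
      using that norm_minus_commute[of v t] by (simp add: add.assoc)
    show ?thesis unfolding main[symmetric] by (rule swap) (use split in simp)
  qed
  also have "\<dots> \<le> norm (contour_integral (linepath l' u) f) + norm (contour_integral (linepath u' l) f)"
    by (rule norm_triangle_ineq)
  also have "\<dots> \<le> 2 * pi * (B1 * (exp R / (exp R - z)) + B2 * (exp (-R) / (z - exp (-R))))"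
    using right left unfolding lens by (simp add: algebra_simps)
  finally show ?thesis unfolding \<zeta>0_def .
qed

section \<open>The symbol of a distribution of orders\<close>

lemma integral_pos_if_AE_pos:
  fixes f :: "'a \<Rightarrow> real"
  assumes int: "integrable M f" and pos: "AE x in M. 0 < f x" and M: "emeasure M (space M) \<noteq> 0"
  shows "0 < (LINT x|M. f x)"
proof -
  have nn: "AE x in M. 0 \<le> f x" using pos by eventually_elim simp
  have "(LINT x|M. f x) \<noteq> 0"
  proof
    assume "(LINT x|M. f x) = 0"
    then have "AE x in M. f x = 0"
      using integral_nonneg_eq_0_iff_AE[OF int nn] by simp
    with pos have "AE x in M. False" by eventually_elim simp
    then show False using M AE_iff_measurable[of "space M" M "\<lambda>_. False"] by simp
  qed
  with integral_nonneg_AE[OF nn] show ?thesis by simp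
qed

locale order_distribution = finite_measure \<nu> for \<nu> :: "real measure" +
  fixes a b :: real
  assumes a_pos: "0 < a" and a_le_b: "a \<le> b" and b_less_1: "b < 1"
    and sets_nu [measurable_cong, simp]: "sets \<nu> = sets borel"
    and nu_nonzero: "emeasure \<nu> UNIV \<noteq> 0"
    and nu_supp: "emeasure \<nu> (- {a..b}) = 0"
begin

lemma space_nu [simp]: "space \<nu> = UNIV"
  using sets_eq_imp_space_eq[OF sets_nu] by simp

lemma borel_measurable_nu [simp]: "borel_measurable \<nu> = borel_measurable borel"
  by (rule measurable_cong_sets) auto

lemma AE_order: "AE \<alpha> in \<nu>. a \<le> \<alpha> \<and> \<alpha> \<le> b"
  by (rule AE_I[where N = "- {a..b}"]) (auto simp: nu_supp)

lemma mass_pos: "0 < measure \<nu> UNIV"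
  using nu_nonzero emeasure_eq_measure[of UNIV] by (simp add: zero_less_measure_iff)

definition char_fun :: "real \<Rightarrow> real" where
  "char_fun z = (LINT \<alpha>|\<nu>. z powr \<alpha>)"

definition symbol :: "complex \<Rightarrow> complex" where
  "symbol \<zeta> = (LINT \<alpha>|\<nu>. exp (of_real \<alpha> * \<zeta>))"

lemma norm_exp_order_le:
  fixes \<zeta> :: complex
  assumes "a \<le> \<alpha> \<and> \<alpha> \<le> b"
  shows "norm (exp (of_real \<alpha> * \<zeta>)) \<le> exp (norm \<zeta>)"
proof -
  have "\<bar>\<alpha>\<bar> * \<bar>Re \<zeta>\<bar> \<le> 1 * norm \<zeta>"
    using assms a_pos b_less_1 by (intro mult_mono abs_Re_le_cmod) auto
  then have "\<alpha> * Re \<zeta> \<le> norm \<zeta>" by (metis abs_le_D1 abs_mult mult_1)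
  then show ?thesis by simp
qed

lemma integrable_exp_order [simp]: "integrable \<nu> (\<lambda>\<alpha>. exp (complex_of_real \<alpha> * \<zeta>))"
proof (rule integrable_const_bound)
  show "AE \<alpha> in \<nu>. norm (exp (complex_of_real \<alpha> * \<zeta>)) \<le> exp (norm \<zeta>)"
    using AE_order by eventually_elim (rule norm_exp_order_le)
qed simp

lemma integrable_powr_order [simp]:
  assumes "0 < z"
  shows "integrable \<nu> (\<lambda>\<alpha>. z powr \<alpha>)"
proof -
  have "integrable \<nu> (\<lambda>\<alpha>. Re (exp (complex_of_real \<alpha> * of_real (ln z))))"
    by (intro integrable_Re integrable_exp_order)
  then show ?thesis using assms by (simp add: powr_def Re_exp)
qed

lemma symbol_of_real: "symbol (of_real x) = of_real (char_fun (exp x))"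
proof -
  have "symbol (of_real x) = (LINT \<alpha>|\<nu>. complex_of_real (exp x powr \<alpha>))"
    unfolding symbol_def by (intro Bochner_Integration.integral_cong) (auto simp: powr_def simp flip: exp_of_real)
  then show ?thesis by (simp add: char_fun_def)
qed

lemma char_fun_ge:
  assumes "0 < z" "\<And>\<alpha>. a \<le> \<alpha> \<Longrightarrow> \<alpha> \<le> b \<Longrightarrow> B \<le> z powr \<alpha>"
  shows "measure \<nu> UNIV * B \<le> char_fun z"
proof -
  have "measure \<nu> UNIV * B = (LINT \<alpha>|\<nu>. B)" by simp
  also have "\<dots> \<le> char_fun z"
    unfolding char_fun_def
  proof (rule integral_mono_AE)
    show "AE \<alpha> in \<nu>. B \<le> z powr \<alpha>" using AE_order by eventually_elim (use assms in auto)
  qed (use assms in auto)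
  finally show ?thesis .
qed

lemma char_fun_ge_powr_a: "1 \<le> z \<Longrightarrow> measure \<nu> UNIV * z powr a \<le> char_fun z"
  by (intro char_fun_ge) (auto intro: powr_mono)

lemma char_fun_ge_powr_b: "0 < z \<Longrightarrow> z \<le> 1 \<Longrightarrow> measure \<nu> UNIV * z powr b \<le> char_fun z"
  by (intro char_fun_ge) (auto intro: powr_mono')

lemma char_fun_pos:
  assumes "0 < z"
  shows "0 < char_fun z"
proof (cases "1 \<le> z")
  case True
  then have "0 < measure \<nu> UNIV * z powr a" using mass_pos by simp
  with char_fun_ge_powr_a[OF True] show ?thesis by linarith
next
  case False
  then have "0 < measure \<nu> UNIV * z powr b" using mass_pos assms by simp
  with char_fun_ge_powr_b[of z] False assms show ?thesis by linarith
qed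

lemma symbol_has_field_derivative:
  "(symbol has_field_derivative (LINT \<alpha>|\<nu>. of_real \<alpha> * exp (of_real \<alpha> * \<zeta>))) (at \<zeta>)"
  unfolding symbol_def
proof (rule has_field_derivative_integral[where r = 1 and g = "\<lambda>_. exp (norm \<zeta> + 1)"
    and f' = "\<lambda>\<zeta> \<alpha>. of_real \<alpha> * exp (of_real \<alpha> * \<zeta>)"])
  show "AE \<alpha> in \<nu>. \<forall>w\<in>ball \<zeta> 1. norm (of_real \<alpha> * exp (of_real \<alpha> * w)) \<le> exp (norm \<zeta> + 1)"
    using AE_order
  proof eventually_elim
    case (elim \<alpha>)
    show ?case
    proof
      fix w assume "w \<in> ball \<zeta> 1"
      then have "norm w \<le> norm \<zeta> + 1"
        using norm_triangle_ineq2[of w \<zeta>] by (simp add: dist_norm norm_minus_commute)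
      then have "norm (exp (of_real \<alpha> * w)) \<le> exp (norm \<zeta> + 1)"
        using norm_exp_order_le[OF elim, of w] by (meson exp_le_cancel_iff order_trans)
      moreover have "norm (complex_of_real \<alpha>) \<le> 1" using elim a_pos b_less_1 by simp
      ultimately show "norm (of_real \<alpha> * exp (of_real \<alpha> * w)) \<le> exp (norm \<zeta> + 1)"
        unfolding norm_mult using mult_mono[of "norm (complex_of_real \<alpha>)" 1] by fastforce
    qed
  qed
qed (auto intro!: derivative_eq_intros)

lemma symbol_holomorphic: "symbol holomorphic_on S"
  using symbol_has_field_derivative by (meson holomorphic_onI field_differentiable_at_within field_differentiable_def)

text \<open>After rotation by the phase belonging to the midpoint of \<open>{a..b}\<close>, all values \<open>exp (\<alpha> \<zeta>)\<close> have
  argument at most \<open>c (b - a) / 2 < pi / 2\<close>, so that their real parts add up without cancellation.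
  Hence the symbol has no zeros in the closed strip, even when this is slightly wider than
  \<open>2 pi\<close>, and it grows as it does on the real line.\<close>
lemma norm_symbol_ge:
  assumes y: "\<bar>Im \<zeta>\<bar> \<le> c" and c: "c * (b - a) < pi"
  shows "cos (c * (b - a) / 2) * char_fun (exp (Re \<zeta>)) \<le> norm (symbol \<zeta>)"
proof -
  define m where "m = (a + b) / 2"
  have rot: "Re (exp (- (\<i> * of_real (m * Im \<zeta>))) * exp (of_real \<alpha> * \<zeta>))
      = exp (Re \<zeta>) powr \<alpha> * cos ((\<alpha> - m) * Im \<zeta>)" for \<alpha>
    by (simp add: exp_add[symmetric] Re_exp powr_def algebra_simps)
  have "cos (c * (b - a) / 2) * char_fun (exp (Re \<zeta>)) = (LINT \<alpha>|\<nu>. cos (c * (b - a) / 2) * exp (Re \<zeta>) powr \<alpha>)"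
    by (simp add: char_fun_def)
  also have "\<dots> \<le> (LINT \<alpha>|\<nu>. Re (exp (- (\<i> * of_real (m * Im \<zeta>))) * exp (of_real \<alpha> * \<zeta>)))"
  proof (rule integral_mono_AE)
    show "AE \<alpha> in \<nu>. cos (c * (b - a) / 2) * exp (Re \<zeta>) powr \<alpha>
        \<le> Re (exp (- (\<i> * of_real (m * Im \<zeta>))) * exp (of_real \<alpha> * \<zeta>))"
      using AE_order
    proof eventually_elim
      case (elim \<alpha>)
      have "\<bar>\<alpha> - m\<bar> \<le> (b - a) / 2" using elim by (auto simp: m_def abs_le_iff field_simps)
      then have "\<bar>(\<alpha> - m) * Im \<zeta>\<bar> \<le> (b - a) / 2 * c"
        unfolding abs_mult using y a_le_b by (intro mult_mono) auto
      then have "cos (c * (b - a) / 2) \<le> cos \<bar>(\<alpha> - m) * Im \<zeta>\<bar>"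
        using c by (intro cos_monotone_0_pi_le) (auto simp: mult_ac)
      then show ?case unfolding rot
        by (simp add: mult.commute[of "exp (Re \<zeta>) powr \<alpha>"] mult_right_mono del: abs_mult)
    qed
  qed (auto intro!: integrable_Re)
  also have "\<dots> = Re (exp (- (\<i> * of_real (m * Im \<zeta>))) * symbol \<zeta>)"
    unfolding symbol_def by (simp add: integral_Re)
  also have "\<dots> \<le> norm (exp (- (\<i> * of_real (m * Im \<zeta>))) * symbol \<zeta>)" by (rule complex_Re_le_cmod)
  also have "\<dots> = norm (symbol \<zeta>)" by (simp add: norm_mult)
  finally show ?thesis .
qed

lemma strip_width:
  obtains c where "pi < c" "c < 2 * pi" "c * (b - a) < pi"
proof -
  define d where "d = b - a"
  have d: "0 \<le> d" "d < 1" using a_pos a_le_b b_less_1 by (auto simp: d_def)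
  \<comment> \<open>\<open>c d < pi\<close> amounts to \<open>(1 - d) (2 - d) > 0\<close>.\<close>
  define c where "c = pi * (3 - d) / 2"
  have "0 < (1 - d) * (2 - d)" using d by simp
  then have "(3 - d) * d < 2" by (simp add: algebra_simps)
  then have "pi * ((3 - d) * d) < pi * 2" by (intro mult_strict_left_mono) auto
  then have "c * d < pi" by (simp add: c_def algebra_simps)
  moreover have "pi < c" "c < 2 * pi"
    using mult_strict_left_mono[of 2 "3 - d" pi] mult_strict_left_mono[of "3 - d" 4 pi] d
    by (auto simp: c_def)
  ultimately show thesis using that by (simp add: d_def)
qed

lemma cos_gap_pos: "0 < cos (pi * (b - a) / 2)"
proof (rule cos_gt_zero_pi)
  have "pi * (b - a) < pi * 1" using a_pos b_less_1 by (intro mult_strict_left_mono) auto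
  then show "pi * (b - a) / 2 < pi / 2" by simp
  have "0 \<le> pi * (b - a)" using a_le_b by simp
  then show "- (pi / 2) < pi * (b - a) / 2" using pi_gt_zero by linarith
qed

section \<open>The jump of the reciprocal symbol\<close>

text \<open>\<open>exp x\<close> times the jump \<open>1 / P (r exp (- \<i> pi)) - 1 / P (r exp (\<i> pi))\<close>, divided by \<open>2 pi \<i>\<close>, at \<open>r = exp x\<close>; the
  factor \<open>exp x\<close> turns a density with respect to \<open>dr\<close> into one with respect to \<open>dx\<close>.\<close>
definition spectral_density :: "real \<Rightarrow> real" where
  "spectral_density x = exp x / pi * Im (symbol (Complex x pi)) / (norm (symbol (Complex x pi)))\<^sup>2"

lemma norm_symbol_ge_strip:
  assumes "\<bar>y\<bar> \<le> pi"
  shows "cos (pi * (b - a) / 2) * char_fun (exp x) \<le> norm (symbol (Complex x y))"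
proof -
  have "pi * (b - a) < pi * 1" using a_pos b_less_1 by (intro mult_strict_left_mono) auto
  then show ?thesis using norm_symbol_ge[of "Complex x y" pi] assms by simp
qed

lemma symbol_nonzero_strip:
  assumes "\<bar>y\<bar> \<le> pi"
  shows "symbol (Complex x y) \<noteq> 0"
proof -
  have "0 < cos (pi * (b - a) / 2) * char_fun (exp x)"
    using cos_gap_pos char_fun_pos by simp
  with norm_symbol_ge_strip[OF assms, of x] show ?thesis by auto
qed

lemma Im_symbol_pos: "0 < Im (symbol (Complex x pi))"
proof -
  have Im_eq: "Im (exp (of_real \<alpha> * Complex x pi)) = exp x powr \<alpha> * sin (\<alpha> * pi)" for \<alpha>
    by (simp add: Im_exp powr_def)
  have int: "integrable \<nu> (\<lambda>\<alpha>. exp x powr \<alpha> * sin (\<alpha> * pi))"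
    unfolding Im_eq[symmetric] by (intro integrable_Im integrable_exp_order)
  have eq: "Im (symbol (Complex x pi)) = (LINT \<alpha>|\<nu>. exp x powr \<alpha> * sin (\<alpha> * pi))"
    unfolding symbol_def Im_eq[symmetric] by (rule integral_Im[symmetric]) simp
  have pos: "AE \<alpha> in \<nu>. 0 < exp x powr \<alpha> * sin (\<alpha> * pi)"
    using AE_order 
  proof eventually_elim
    case (elim \<alpha>)
    then have "0 < \<alpha> * pi" "\<alpha> * pi < 1 * pi"
      using a_pos b_less_1 by (auto intro!: mult_pos_pos mult_strict_right_mono)
    then show ?case by (auto intro!: mult_pos_pos sin_gt_zero)
  qed
  show ?thesis unfolding eq using int pos nu_nonzero by (intro integral_pos_if_AE_pos) auto
qed

lemma spectral_density_pos: "0 < spectral_density x"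
  using Im_symbol_pos[of x] symbol_nonzero_strip[of pi x] pi_gt_zero
  by (simp add: spectral_density_def)

lemma continuous_symbol_line: "continuous_on S (\<lambda>x. symbol (Complex x y))"
  by (rule continuous_on_compose2[OF holomorphic_on_imp_continuous_on[OF symbol_holomorphic[of UNIV]]])
     (auto simp: Complex_eq intro!: continuous_intros)

lemma continuous_spectral_density: "continuous_on S spectral_density"
  unfolding spectral_density_def
  using symbol_nonzero_strip[of pi]
  by (intro continuous_intros continuous_symbol_line) auto

lemma measurable_spectral_density [measurable]: "spectral_density \<in> borel_measurable borel"
  by (rule borel_measurable_continuous_onI[OF continuous_spectral_density])

lemma symbol_cnj: "symbol (cnj \<zeta>) = cnj (symbol \<zeta>)"
proof -
  have "cnj (symbol \<zeta>) = (LINT \<alpha>|\<nu>. cnj (exp (of_real \<alpha> * \<zeta>)))"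
    unfolding symbol_def by simp
  also have "\<dots> = symbol (cnj \<zeta>)" unfolding symbol_def by (simp add: exp_cnj)
  finally show ?thesis ..
qed

lemma jump_of_reciprocal_symbol:
  "(1 / symbol (Complex x (-pi)) - 1 / symbol (Complex x pi)) * of_real (exp x / (exp x + z))
    = 2 * of_real pi * \<i> * of_real (spectral_density x / (exp x + z))"
proof -
  define w where "w = symbol (Complex x pi)"
  have w: "w \<noteq> 0" unfolding w_def by (rule symbol_nonzero_strip) simp
  have "symbol (Complex x (-pi)) = cnj w"
    using symbol_cnj[of "Complex x pi"] by (simp add: w_def cnj.code)
  moreover have "1 / cnj w - 1 / w = 2 * \<i> * of_real (Im w / (norm w)\<^sup>2)"
  proof -
    have "1 / cnj w - 1 / w = (w - cnj w) / (w * cnj w)" using w by (simp add: field_simps)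
    also have "\<dots> = (2 * \<i> * of_real (Im w)) / of_real ((norm w)\<^sup>2)"
      unfolding complex_norm_square by (simp add: complex_diff_cnj mult_ac)
    finally show ?thesis by simp
  qed
  ultimately show ?thesis by (simp add: spectral_density_def w_def)
qed

text \<open>The error terms of \<open>strip_residue_estimate\<close> decay like \<open>exp (- a R)\<close> on the right side of the rectangle
  and like \<open>exp (- (1 - b) R)\<close> on the left side, so the truncated integrals converge; as the
  integrand is positive, this also gives its integrability.\<close>
lemma stieltjes_transform_spectral_density:
  assumes z: "0 < z"
  shows "has_bochner_integral lborel (\<lambda>x. spectral_density x / (exp x + z)) (1 / char_fun z)"
proof -
  define \<rho> where "\<rho> x = spectral_density x / (exp x + z)" for x
  have nz: "exp x + z \<noteq> 0" for x using z exp_gt_zero[of x] by linarith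
  have \<rho>_cont: "continuous_on S \<rho>" for S
    unfolding \<rho>_def by (intro continuous_intros continuous_spectral_density) (use nz in auto)
  have \<rho>_pos: "0 < \<rho> x" for x
    using spectral_density_pos[of x] z by (simp add: \<rho>_def add_pos_pos)
  define K where "K = cos (pi * (b - a) / 2) * measure \<nu> UNIV"
  have K: "0 < K" using cos_gap_pos mass_pos by (simp add: K_def)
  define err where "err R = 1 / (K * exp (a * R)) * (exp R / (exp R - z))
      + 1 / (K * exp (- b * R)) * (exp (- R) / (z - exp (- R)))" for R
  have approx: "\<bar>integral {-R..R} \<rho> - 1 / char_fun z\<bar> \<le> err R" if R: "\<bar>ln z\<bar> < R" for R
  proof -
    obtain c where c: "pi < c" "c < 2 * pi" "c * (b - a) < pi" by (rule strip_width)
    have nonzero: "symbol \<zeta> \<noteq> 0" if "\<bar>Im \<zeta>\<bar> < c" for \<zeta>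
    proof -
      have "0 \<le> c * (b - a)" using c a_le_b pi_gt_zero by simp
      then have "0 < cos (c * (b - a) / 2)" using c by (intro cos_gt_zero_pi) auto
      then have "0 < cos (c * (b - a) / 2) * char_fun (exp (Re \<zeta>))" using char_fun_pos by simp
      also have "\<dots> \<le> norm (symbol \<zeta>)" using norm_symbol_ge[of \<zeta> c] that c by simp
      finally show ?thesis by auto
    qed
    have bound: "norm (1 / symbol (Complex x y)) \<le> 1 / (K * B)"
      if "\<bar>y\<bar> \<le> pi" "measure \<nu> UNIV * B \<le> char_fun (exp x)" "0 < B" for x y B
    proof -
      have "K * B \<le> cos (pi * (b - a) / 2) * char_fun (exp x)"
        using that cos_gap_pos by (simp add: K_def mult.assoc)
      also have "\<dots> \<le> norm (symbol (Complex x y))" by (rule norm_symbol_ge_strip) fact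
      finally show ?thesis
        using K that by (simp add: norm_divide frac_le)
    qed
    have "norm (integral {-R..R} (\<lambda>x. (1 / symbol (Complex x (-pi)) - 1 / symbol (Complex x pi)) * of_real (exp x / (exp x + z)))
      - 2 * of_real pi * \<i> * (1 / symbol (of_real (ln z)))) \<le> 2 * pi * err R"
      unfolding err_def
    proof (rule strip_residue_estimate[OF _ c(1,2) z R])
      show "(\<lambda>\<zeta>. 1 / symbol \<zeta>) holomorphic_on {\<zeta>. \<bar>Im \<zeta>\<bar> < c}"
        using nonzero by (intro holomorphic_intros symbol_holomorphic) auto
      fix y :: real assume y: "\<bar>y\<bar> \<le> pi"
      show "norm (1 / symbol (Complex R y)) \<le> 1 / (K * exp (a * R))"
        using bound[OF y, of "exp (a * R)" R] char_fun_ge_powr_a[of "exp R"] R by (simp add: powr_def)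
      show "norm (1 / symbol (Complex (- R) y)) \<le> 1 / (K * exp (- b * R))"
        using bound[OF y, of "exp (- b * R)" "- R"] char_fun_ge_powr_b[of "exp (- R)"] R by (simp add: powr_def)
    qed
    also have "integral {-R..R} (\<lambda>x. (1 / symbol (Complex x (-pi)) - 1 / symbol (Complex x pi)) * of_real (exp x / (exp x + z)))
        = 2 * of_real pi * \<i> * of_real (integral {-R..R} \<rho>)"
    proof -
      have "integral {-R..R} (of_real \<circ> \<rho>) = complex_of_real (integral {-R..R} \<rho>)"
        by (intro integral_linear integrable_continuous_interval \<rho>_cont bounded_linear_of_real)
      then show ?thesis unfolding jump_of_reciprocal_symbol Henstock_Kurzweil_Integration.integral_mult_right
        by (simp add: comp_def \<rho>_def[abs_def])
    qed
    also have "symbol (of_real (ln z)) = of_real (char_fun z)" using z by (simp add: symbol_of_real)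
    also have "2 * of_real pi * \<i> * of_real (integral {-R..R} \<rho>) - 2 * of_real pi * \<i> * (1 / of_real (char_fun z))
        = (2 * of_real pi * \<i>) * complex_of_real (integral {-R..R} \<rho> - 1 / char_fun z)"
      by (simp add: algebra_simps)
    also have "norm \<dots> = 2 * pi * \<bar>integral {-R..R} \<rho> - 1 / char_fun z\<bar>"
      unfolding norm_mult norm_of_real by simp
    finally show ?thesis by simp
  qed
  have err_lim: "(\<lambda>n. err (real n)) \<longlonglongrightarrow> 0"
  proof -
    have "(err \<longlongrightarrow> 0) at_top"
    proof -
      define d where "d = 1 - b"
      have d: "0 < d" using b_less_1 by (simp add: d_def)
      have "((\<lambda>R. exp (- a * R)) \<longlongrightarrow> 0) at_top" using a_pos by - real_asymp
      moreover have "((\<lambda>R. exp R / (exp R - z)) \<longlongrightarrow> 1) at_top" by real_asymp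
      moreover have "((\<lambda>R. exp (- d * R)) \<longlongrightarrow> 0) at_top" using d by - real_asymp
      moreover have "((\<lambda>R. 1 / (z - exp (- R))) \<longlongrightarrow> inverse z) at_top" using z by - real_asymp
      ultimately have "((\<lambda>R. 1 / K * (exp (- a * R) * (exp R / (exp R - z)) + exp (- d * R) * (1 / (z - exp (- R)))))
          \<longlongrightarrow> 1 / K * (0 * 1 + 0 * inverse z)) at_top"
        by (intro tendsto_intros)
      also have "(\<lambda>R. 1 / K * (exp (- a * R) * (exp R / (exp R - z)) + exp (- d * R) * (1 / (z - exp (- R))))) = err"
      proof
        fix R
        have "exp (- d * R) = exp (b * R) * exp (- R)" by (simp add: d_def algebra_simps flip: exp_add)
        then show "1 / K * (exp (- a * R) * (exp R / (exp R - z)) + exp (- d * R) * (1 / (z - exp (- R)))) = err R"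
          by (simp add: err_def exp_minus divide_inverse algebra_simps)
      qed
      finally show ?thesis by simp
    qed
    then show ?thesis by (rule filterlim_compose[OF _ filterlim_real_sequentially])
  qed
  have int: "set_integrable lborel {-R..R} \<rho>" for R by (intro borel_integrable_atLeastAtMost' \<rho>_cont)
  have "(\<lambda>n. integral {- real n..real n} \<rho> - 1 / char_fun z) \<longlonglongrightarrow> 0"
  proof (rule Lim_null_comparison[OF _ err_lim])
    obtain N :: nat where "\<bar>ln z\<bar> < N" using reals_Archimedean2 by blast
    then have "\<forall>n\<ge>N. norm (integral {- real n..real n} \<rho> - 1 / char_fun z) \<le> err (real n)"
      using approx by auto
    then show "\<forall>\<^sub>F n in sequentially. norm (integral {- real n..real n} \<rho> - 1 / char_fun z) \<le> err (real n)"
      by (auto simp: eventually_sequentially)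
  qed
  then have lim: "(\<lambda>n. integral {- real n..real n} \<rho>) \<longlonglongrightarrow> 1 / char_fun z"
    by (simp add: LIM_zero_iff)
  have "has_bochner_integral lborel \<rho> (1 / char_fun z)"
  proof (rule has_bochner_integral_monotone_convergence[where f = "\<lambda>n x. indicator {- real n..real n} x * \<rho> x"])
    show "integrable lborel (\<lambda>x. indicator {- real n..real n} x * \<rho> x)" for n
      using int[of "real n"] by (simp add: set_integrable_def)
    show "AE x in lborel. mono (\<lambda>n. indicator {- real n..real n} x * \<rho> x)"
      using \<rho>_pos by (auto simp: mono_def indicator_def less_imp_le)
    show "AE x in lborel. (\<lambda>n. indicator {- real n..real n} x * \<rho> x) \<longlonglongrightarrow> \<rho> x"
    proof (intro AE_I2 tendsto_eventually)
      fix x :: real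
      obtain N :: nat where "\<bar>x\<bar> < N" using reals_Archimedean2 by blast
      then have "\<forall>n\<ge>N. indicator {- real n..real n} x * \<rho> x = \<rho> x" by (auto simp: indicator_def)
      then show "\<forall>\<^sub>F n in sequentially. indicator {- real n..real n} x * \<rho> x = \<rho> x"
        by (auto simp: eventually_sequentially)
    qed
    show "(\<lambda>n. LBINT x. indicator {- real n..real n} x * \<rho> x) \<longlonglongrightarrow> 1 / char_fun z"
      using lim set_borel_integral_eq_integral(2)[OF int] by (simp add: set_lebesgue_integral_def)
    show "\<rho> \<in> borel_measurable lborel"
      using borel_measurable_continuous_onI[OF \<rho>_cont] by simp
  qed
  then show ?thesis by (simp add: \<rho>_def[abs_def])
qed

end

section \<open>The associated kernel as a mixture of exponentials\<close>

context order_distribution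
begin

definition sonine_kernel :: "real \<Rightarrow> real" where
  "sonine_kernel t = (LBINT x. exp (- t * exp x) * spectral_density x)"

lemma integrable_sonine_integrand:
  assumes t: "0 < t"
  shows "integrable lborel (\<lambda>x. exp (- t * exp x) * spectral_density x)"
proof (rule Bochner_Integration.integrable_bound)
  show "integrable lborel (\<lambda>x. (2 / t + 1) * (spectral_density x / (exp x + 1)))"
    using stieltjes_transform_spectral_density[of 1] by (intro integrable_mult_right) (auto simp: has_bochner_integral_iff)
  show "AE x in lborel. norm (exp (- t * exp x) * spectral_density x)
      \<le> norm ((2 / t + 1) * (spectral_density x / (exp x + 1)))"
  proof (intro AE_I2)
    fix x :: real
    have pos: "0 < exp x + 1" by (simp add: add_pos_pos)
    have "exp x \<le> 2 / t * exp (t * exp x)" using power_le_exp_mult[OF t, of "exp x" 1] by simp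
    moreover have "1 \<le> exp (t * exp x)" using t by simp
    ultimately have "exp x + 1 \<le> 2 / t * exp (t * exp x) + exp (t * exp x)" by (rule add_mono)
    also have "\<dots> = (2 / t + 1) * exp (t * exp x)" by (simp add: distrib_right)
    finally have "exp x + 1 \<le> (2 / t + 1) * exp (t * exp x)" .
    then have "exp (- t * exp x) \<le> (2 / t + 1) / (exp x + 1)"
      using pos by (simp add: exp_minus field_simps)
    then have "exp (- t * exp x) * spectral_density x \<le> (2 / t + 1) / (exp x + 1) * spectral_density x"
      using spectral_density_pos by (intro mult_right_mono) (auto simp: less_imp_le)
    then show "norm (exp (- t * exp x) * spectral_density x) \<le> norm ((2 / t + 1) * (spectral_density x / (exp x + 1)))"
      using spectral_density_pos[of x] pos t by (simp add: abs_mult)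
  qed
qed measurable

lemma measurable_sonine_kernel [measurable]: "sonine_kernel \<in> borel_measurable borel"
  unfolding sonine_kernel_def[abs_def] by measurable

lemma sonine_kernel_pos: "0 < t \<Longrightarrow> 0 < sonine_kernel t"
  unfolding sonine_kernel_def
  by (intro integral_pos_if_AE_pos integrable_sonine_integrand) (auto simp: spectral_density_pos)

lemma sonine_kernel_antimono:
  assumes "0 < s" "s \<le> t"
  shows "sonine_kernel t \<le> sonine_kernel s"
  unfolding sonine_kernel_def using assms spectral_density_pos
  by (intro integral_mono integrable_sonine_integrand) (auto simp: less_imp_le intro!: mult_right_mono)

lemma completely_monotone_sonine_kernel: "completely_monotone sonine_kernel"
  unfolding sonine_kernel_def[abs_def]
  by (rule completely_monotone_laplace_mixture)
     (use integrable_sonine_integrand in \<open>auto simp: spectral_density_pos less_imp_le\<close>)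

text \<open>The Laplace transform of a Laplace transform is a Stieltjes transform.\<close>
lemma nn_laplace_sonine_kernel:
  assumes z: "0 < z"
  shows "(\<integral>\<^sup>+t. indicator {0<..} t * ennreal (exp (- z * t) * sonine_kernel t) \<partial>lborel) = ennreal (1 / char_fun z)"
proof -
  have W: "0 \<le> spectral_density x" for x using spectral_density_pos by (simp add: less_imp_le)
  have "(\<integral>\<^sup>+t. indicator {0<..} t * ennreal (exp (- z * t) * sonine_kernel t) \<partial>lborel)
      = (\<integral>\<^sup>+t. (\<integral>\<^sup>+x. ennreal (spectral_density x) * (indicator {0<..} t * ennreal (exp (- (exp x + z) * t))) \<partial>lborel) \<partial>lborel)"
  proof (intro nn_integral_cong)
    fix t :: real
    show "indicator {0<..} t * ennreal (exp (- z * t) * sonine_kernel t)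
        = (\<integral>\<^sup>+x. ennreal (spectral_density x) * (indicator {0<..} t * ennreal (exp (- (exp x + z) * t))) \<partial>lborel)"
    proof (cases "0 < t")
      case True
      have "ennreal (exp (- z * t) * sonine_kernel t) = ennreal (LBINT x. exp (- z * t) * (exp (- t * exp x) * spectral_density x))"
        by (simp add: sonine_kernel_def)
      also have "\<dots> = (\<integral>\<^sup>+x. ennreal (exp (- z * t) * (exp (- t * exp x) * spectral_density x)) \<partial>lborel)"
        using W integrable_sonine_integrand[OF True]
        by (intro nn_integral_eq_integral[symmetric] integrable_mult_right) auto
      also have "\<dots> = (\<integral>\<^sup>+x. ennreal (spectral_density x) * ennreal (exp (- (exp x + z) * t)) \<partial>lborel)"
      proof (intro nn_integral_cong)
        fix x :: real
        have "exp (- z * t) * (exp (- t * exp x) * spectral_density x) = spectral_density x * exp (- (exp x + z) * t)"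
          by (simp add: algebra_simps flip: exp_add)
        then show "ennreal (exp (- z * t) * (exp (- t * exp x) * spectral_density x))
            = ennreal (spectral_density x) * ennreal (exp (- (exp x + z) * t))"
          using W by (simp only: ennreal_mult exp_ge_zero)
      qed
      finally show ?thesis using True by simp
    qed simp
  qed
  also have "\<dots> = (\<integral>\<^sup>+x. (\<integral>\<^sup>+t. ennreal (spectral_density x) * (indicator {0<..} t * ennreal (exp (- (exp x + z) * t))) \<partial>lborel) \<partial>lborel)"
    by (intro lborel_pair.Fubini') measurable
  also have "\<dots> = (\<integral>\<^sup>+x. ennreal (spectral_density x / (exp x + z)) \<partial>lborel)"
  proof (intro nn_integral_cong)
    fix x :: real
    have pos: "0 < exp x + z" using z by (simp add: add_pos_pos)
    have "(\<integral>\<^sup>+t. ennreal (spectral_density x) * (indicator {0<..} t * ennreal (exp (- (exp x + z) * t))) \<partial>lborel)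
        = ennreal (spectral_density x) * ennreal (1 / (exp x + z))"
      unfolding nn_integral_exp_Ioi[OF pos, symmetric] by (intro nn_integral_cmult) measurable
    then show "(\<integral>\<^sup>+t. ennreal (spectral_density x) * (indicator {0<..} t * ennreal (exp (- (exp x + z) * t))) \<partial>lborel)
        = ennreal (spectral_density x / (exp x + z))"
      using W pos by (simp flip: ennreal_mult)
  qed
  also have "\<dots> = ennreal (1 / char_fun z)"
    using stieltjes_transform_spectral_density[OF z] W z
    by (subst nn_integral_eq_integral) (auto simp: has_bochner_integral_iff add_pos_pos less_imp_le)
  finally show ?thesis .
qed

end

section \<open>The kernel of a distribution of orders and the Sonine identity\<close>

lemma borel_measurable_Gamma_real [measurable]: "(Gamma :: real \<Rightarrow> real) \<in> borel_measurable borel"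
proof -
  have "(rGamma :: real \<Rightarrow> real) \<in> borel_measurable borel"
    by (intro borel_measurable_continuous_onI continuous_on_rGamma)
  then have "(\<lambda>x :: real. inverse (rGamma x)) \<in> borel_measurable borel" by measurable
  then show ?thesis by (simp add: rGamma_inverse_Gamma)
qed

lemma nn_laplace_transform_powr:
  fixes s z :: real
  assumes s: "0 < s" and z: "0 < z"
  shows "(\<integral>\<^sup>+t. indicator {0<..} t * ennreal (exp (- z * t) * t powr (s - 1)) \<partial>lborel) = ennreal (Gamma s * z powr (- s))"
proof -
  have "ennreal (Gamma s) = (\<integral>\<^sup>+t. ennreal (indicator {0..} t * t powr (s - 1) / exp t) \<partial>lborel)"
    by (rule Gamma_conv_nn_integral_real[OF s])
  also have "\<dots> = ennreal z * (\<integral>\<^sup>+t. ennreal (indicator {0..} (0 + z * t) * (0 + z * t) powr (s - 1) / exp (0 + z * t)) \<partial>lborel)"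
    using z by (subst nn_integral_real_affine[where c = z and t = 0]) auto
  also have "(\<integral>\<^sup>+t. ennreal (indicator {0..} (0 + z * t) * (0 + z * t) powr (s - 1) / exp (0 + z * t)) \<partial>lborel)
      = (\<integral>\<^sup>+t. ennreal (z powr (s - 1)) * (indicator {0<..} t * ennreal (exp (- z * t) * t powr (s - 1))) \<partial>lborel)"
  proof (rule nn_integral_cong_AE)
    show "AE t in lborel. ennreal (indicator {0..} (0 + z * t) * (0 + z * t) powr (s - 1) / exp (0 + z * t))
        = ennreal (z powr (s - 1)) * (indicator {0<..} t * ennreal (exp (- z * t) * t powr (s - 1)))"
      using AE_lborel_singleton[of 0]
    proof eventually_elim
      case (elim t)
      show ?case
      proof (cases "0 < t")
        case True
        then show ?thesis using z
          by (simp add: powr_mult exp_minus divide_inverse mult_ac flip: ennreal_mult)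
      next
        case False
        with elim have "z * t < 0" using z by (simp add: mult_pos_neg)
        then show ?thesis using False by simp
      qed
    qed
  qed
  also have "\<dots> = ennreal (z powr (s - 1)) * (\<integral>\<^sup>+t. indicator {0<..} t * ennreal (exp (- z * t) * t powr (s - 1)) \<partial>lborel)"
    by (intro nn_integral_cmult) measurable
  finally have "ennreal (z powr (- s)) * ennreal (Gamma s) = ennreal (z powr (- s)) * (ennreal z * (ennreal (z powr (s - 1)) *
      (\<integral>\<^sup>+t. indicator {0<..} t * ennreal (exp (- z * t) * t powr (s - 1)) \<partial>lborel)))" by simp
  also have "\<dots> = ennreal (z powr (- s) * (z powr 1 * z powr (s - 1))) * (\<integral>\<^sup>+t. indicator {0<..} t * ennreal (exp (- z * t) * t powr (s - 1)) \<partial>lborel)"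
    using z by (simp add: ennreal_mult mult.assoc)
  also have "z powr (- s) * (z powr 1 * z powr (s - 1)) = 1"
    using z unfolding powr_add[symmetric] by simp
  finally show ?thesis using s by (simp add: mult.commute flip: ennreal_mult)
qed

context order_distribution
begin

lemma integrable_h_ker:
  assumes t: "0 < t"
  shows "integrable \<nu> (\<lambda>\<alpha>. h_ker (1 - \<alpha>) t)"
proof -
  have "compact (rGamma ` {1 - b..1 - a :: real})"
    by (intro compact_continuous_image continuous_on_rGamma compact_Icc)
  then obtain C where C: "\<And>s. s \<in> {1 - b..1 - a} \<Longrightarrow> \<bar>rGamma s\<bar> \<le> C"
    by (meson bounded_real compact_imp_bounded imageI)
  show ?thesis
  proof (rule Bochner_Integration.integrable_bound)
    show "integrable \<nu> (\<lambda>\<alpha>. (1 / t) powr \<alpha> * C)" using t by simp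
    show "(\<lambda>\<alpha>. h_ker (1 - \<alpha>) t) \<in> borel_measurable \<nu>" unfolding h_ker_def by measurable
    show "AE \<alpha> in \<nu>. norm (h_ker (1 - \<alpha>) t) \<le> norm ((1 / t) powr \<alpha> * C)"
      using AE_order
    proof eventually_elim
      case (elim \<alpha>)
      have "norm (h_ker (1 - \<alpha>) t) = (1 / t) powr \<alpha> * \<bar>rGamma (1 - \<alpha>)\<bar>"
        using t by (simp add: h_ker_def rGamma_inverse_Gamma divide_inverse abs_mult powr_minus inverse_powr)
      also have "\<dots> \<le> (1 / t) powr \<alpha> * C" using C[of "1 - \<alpha>"] elim by (intro mult_left_mono) auto
      also have "\<dots> \<le> norm ((1 / t) powr \<alpha> * C)" by simp
      finally show ?case .
    qed
  qed
qed

lemma AE_h_ker_nonneg: "AE \<alpha> in \<nu>. 0 \<le> h_ker (1 - \<alpha>) t"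
  using AE_order by eventually_elim (use b_less_1 in \<open>auto simp: h_ker_def intro!: divide_nonneg_pos Gamma_real_pos\<close>)

lemma k_ker_eq: "k_ker \<nu> t = (LINT \<alpha>|\<nu>. h_ker (1 - \<alpha>) t)"
  unfolding k_ker_def set_lebesgue_integral_def
proof (rule integral_cong_AE)
  show "AE \<alpha> in \<nu>. indicator {0<..<1} \<alpha> *\<^sub>R h_ker (1 - \<alpha>) t = h_ker (1 - \<alpha>) t"
    using AE_order by eventually_elim (use a_pos b_less_1 in auto)
qed (unfold h_ker_def, measurable)

lemma measurable_k_ker [measurable]: "k_ker \<nu> \<in> borel_measurable borel"
  unfolding k_ker_eq[abs_def] h_ker_def by measurable

lemma k_ker_nonneg: "0 \<le> k_ker \<nu> t"
  unfolding k_ker_eq by (rule integral_nonneg_AE[OF AE_h_ker_nonneg])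

lemma k_ker_antimono:
  assumes "0 < s" "s \<le> t"
  shows "k_ker \<nu> t \<le> k_ker \<nu> s"
  unfolding k_ker_eq
proof (rule integral_mono_AE)
  show "AE \<alpha> in \<nu>. h_ker (1 - \<alpha>) t \<le> h_ker (1 - \<alpha>) s"
    using AE_order
  proof eventually_elim
    case (elim \<alpha>)
    then have "0 \<le> Gamma (1 - \<alpha>)" using b_less_1 by (intro less_imp_le Gamma_real_pos) auto
    then show ?case
      using elim assms a_pos by (auto simp: h_ker_def intro!: divide_right_mono powr_mono2')
  qed
qed (use assms in \<open>auto intro!: integrable_h_ker\<close>)

lemma nn_laplace_k_ker:
  assumes z: "0 < z"
  shows "(\<integral>\<^sup>+t. indicator {0<..} t * ennreal (exp (- z * t) * k_ker \<nu> t) \<partial>lborel) = ennreal (char_fun z / z)"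
proof -
  interpret lborel_nu: pair_sigma_finite lborel \<nu> ..
  have "(\<integral>\<^sup>+t. indicator {0<..} t * ennreal (exp (- z * t) * k_ker \<nu> t) \<partial>lborel)
      = (\<integral>\<^sup>+t. (\<integral>\<^sup>+\<alpha>. indicator {0<..} t * ennreal (exp (- z * t) * h_ker (1 - \<alpha>) t) \<partial>\<nu>) \<partial>lborel)"
  proof (intro nn_integral_cong)
    fix t :: real
    show "indicator {0<..} t * ennreal (exp (- z * t) * k_ker \<nu> t)
        = (\<integral>\<^sup>+\<alpha>. indicator {0<..} t * ennreal (exp (- z * t) * h_ker (1 - \<alpha>) t) \<partial>\<nu>)"
    proof (cases "0 < t")
      case True
      have "ennreal (exp (- z * t) * k_ker \<nu> t) = ennreal (LINT \<alpha>|\<nu>. exp (- z * t) * h_ker (1 - \<alpha>) t)"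
        by (simp add: k_ker_eq)
      also have "\<dots> = (\<integral>\<^sup>+\<alpha>. ennreal (exp (- z * t) * h_ker (1 - \<alpha>) t) \<partial>\<nu>)"
        using AE_h_ker_nonneg[of t] integrable_h_ker[OF True]
        by (intro nn_integral_eq_integral[symmetric] integrable_mult_right) auto
      finally show ?thesis using True by simp
    qed simp
  qed
  also have "\<dots> = (\<integral>\<^sup>+\<alpha>. (\<integral>\<^sup>+t. indicator {0<..} t * ennreal (exp (- z * t) * h_ker (1 - \<alpha>) t) \<partial>lborel) \<partial>\<nu>)"
    by (rule lborel_nu.Fubini'[symmetric]) (unfold h_ker_def, measurable)
  also have "\<dots> = (\<integral>\<^sup>+\<alpha>. ennreal (z powr \<alpha> / z) \<partial>\<nu>)"
  proof (rule nn_integral_cong_AE)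
    show "AE \<alpha> in \<nu>. (\<integral>\<^sup>+t. indicator {0<..} t * ennreal (exp (- z * t) * h_ker (1 - \<alpha>) t) \<partial>lborel) = ennreal (z powr \<alpha> / z)"
      using AE_order
    proof eventually_elim
      case (elim \<alpha>)
      then have s: "0 < 1 - \<alpha>" using b_less_1 by simp
      then have G: "0 < Gamma (1 - \<alpha>)" by (rule Gamma_real_pos)
      have "(\<integral>\<^sup>+t. indicator {0<..} t * ennreal (exp (- z * t) * h_ker (1 - \<alpha>) t) \<partial>lborel)
          = (\<integral>\<^sup>+t. ennreal (1 / Gamma (1 - \<alpha>)) * (indicator {0<..} t * ennreal (exp (- z * t) * t powr (1 - \<alpha> - 1))) \<partial>lborel)"
        using G by (intro nn_integral_cong) (auto simp: h_ker_def indicator_def simp flip: ennreal_mult)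
      also have "\<dots> = ennreal (1 / Gamma (1 - \<alpha>)) * ennreal (Gamma (1 - \<alpha>) * z powr (- (1 - \<alpha>)))"
        unfolding nn_laplace_transform_powr[OF s z, symmetric] by (intro nn_integral_cmult) measurable
      also have "\<dots> = ennreal (z powr \<alpha> / z)"
        using G z by (simp add: powr_diff flip: ennreal_mult)
      finally show ?case .
    qed
  qed
  also have "\<dots> = ennreal (char_fun z / z)"
    using z by (subst nn_integral_eq_integral) (auto simp: char_fun_def)
  finally show ?thesis .
qed

theorem sonine_pair: "sonine_pair_on {0<..} sonine_kernel (k_ker \<nu>)"
  unfolding sonine_pair_on_def
proof
  fix t :: real assume "t \<in> {0<..}"
  show "volterra sonine_kernel (k_ker \<nu>) t = 1"
  proof (rule volterra_eq_1_if_laplace)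
    fix z :: real assume z: "0 < z"
    show "(\<integral>\<^sup>+t. indicator {0<..} t * ennreal (exp (- z * t) * sonine_kernel t) \<partial>lborel)
      * (\<integral>\<^sup>+t. indicator {0<..} t * ennreal (exp (- z * t) * k_ker \<nu> t) \<partial>lborel) = ennreal (1 / z)"
      unfolding nn_laplace_sonine_kernel[OF z] nn_laplace_k_ker[OF z]
      using char_fun_pos[OF z] z by (simp flip: ennreal_mult)
  qed (use \<open>t \<in> {0<..}\<close> in \<open>auto intro: sonine_kernel_antimono k_ker_antimono k_ker_nonneg sonine_kernel_pos less_imp_le\<close>)
qed

end

section \<open>Integrability and growth of the associated kernel\<close>

lemma laplace_eq_if_nn_laplace:
  fixes f :: "real \<Rightarrow> real"
  assumes [measurable]: "f \<in> borel_measurable borel" and nn: "\<And>t. 0 < t \<Longrightarrow> 0 \<le> f t" and v: "0 \<le> v"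
    and lap: "(\<integral>\<^sup>+t. indicator {0<..} t * ennreal (exp (- z * t) * f t) \<partial>lborel) = ennreal v"
  shows "set_integrable lborel {0<..} (\<lambda>t. exp (- z * t) * f t)" and "laplace f z = v"
proof -
  have "(\<integral>\<^sup>+t. ennreal (indicator {0<..} t * (exp (- z * t) * f t)) \<partial>lborel) = ennreal v"
    unfolding lap[symmetric] by (intro nn_integral_cong) (auto simp: indicator_def)
  moreover have "0 \<le> indicator {0<..} t * (exp (- z * t) * f t)" for t
    using nn by (auto simp: indicator_def)
  ultimately show "set_integrable lborel {0<..} (\<lambda>t. exp (- z * t) * f t)" "laplace f z = v"
    using v unfolding laplace_def set_integrable_def set_lebesgue_integral_def real_scaleR_def
    by (auto intro!: integrableI_nonneg simp: integral_eq_nn_integral)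
qed

lemma L1_loc_if_laplace_integrable:
  fixes f :: "real \<Rightarrow> real"
  assumes [measurable]: "f \<in> borel_measurable borel"
    and int: "set_integrable lborel {0<..} (\<lambda>t. exp (- z * t) * f t)" and z: "0 \<le> z"
  shows "L1_loc f"
  unfolding L1_loc_def L1_on_def set_integrable_def
proof (intro allI impI, rule Bochner_Integration.integrable_bound)
  fix T :: real assume "0 < T"
  show "integrable lborel (\<lambda>t. exp (z * T) *\<^sub>R (indicator {0<..} t *\<^sub>R (exp (- z * t) * f t)))"
    using int unfolding set_integrable_def by (rule integrable_scaleR_right)
  have "\<bar>f t\<bar> \<le> exp (z * T) * (exp (- z * t) * \<bar>f t\<bar>)" if "0 < t" "t < T" for t
  proof -
    have "1 \<le> exp (z * T) * exp (- z * t)"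
      using that z by (simp add: mult_left_mono flip: exp_add)
    then show ?thesis
      using mult_right_mono[of 1 "exp (z * T) * exp (- z * t)" "\<bar>f t\<bar>"] by (simp add: mult.assoc)
  qed
  then show "AE t in lborel. norm (indicator {0<..<T} t *\<^sub>R f t)
      \<le> norm (exp (z * T) *\<^sub>R (indicator {0<..} t *\<^sub>R (exp (- z * t) * f t)))"
    by (auto simp: indicator_def abs_mult)
qed measurable

text \<open>On \<open>{0<..<t}\<close> the weight is at least \<open>exp (- 1)\<close> and \<open>f\<close> is at least \<open>f t\<close>.\<close>
lemma le_laplace_if_antimono:
  fixes f :: "real \<Rightarrow> real"
  assumes int: "set_integrable lborel {0<..} (\<lambda>s. exp (- (1 / t) * s) * f s)"
    and nn: "\<And>t. 0 < t \<Longrightarrow> 0 \<le> f t" and anti: "\<And>s t. 0 < s \<Longrightarrow> s \<le> t \<Longrightarrow> f t \<le> f s" and t: "0 < t"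
  shows "f t * t \<le> exp 1 * laplace f (1 / t)"
proof -
  have "exp (- 1) * f t * t = (LBINT s. indicator {0<..<t} s * (exp (- 1) * f t))"
    using t by simp
  also have "\<dots> \<le> laplace f (1 / t)"
    unfolding laplace_def set_lebesgue_integral_def real_scaleR_def
  proof (rule integral_mono)
    fix s :: real
    have "exp (- 1) * f t \<le> exp (- (1 / t) * s) * f s" if "0 < s" "s < t"
      using that t by (intro mult_mono anti nn) (auto simp: field_simps)
    then show "indicator {0<..<t} s * (exp (- 1) * f t) \<le> indicator {0<..} s * (exp (- (1 / t) * s) * f s)"
      using nn by (auto simp: indicator_def)
  qed (use int t in \<open>auto simp: set_integrable_def\<close>)
  finally show ?thesis by (simp add: exp_minus field_simps)
qed

context order_distribution
begin

lemma laplace_sonine_kernel: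
  assumes "0 < z"
  shows "set_integrable lborel {0<..} (\<lambda>t. exp (- z * t) * sonine_kernel t)"
    and "laplace sonine_kernel z = 1 / char_fun z"
  using laplace_eq_if_nn_laplace[OF measurable_sonine_kernel _ _ nn_laplace_sonine_kernel[OF assms]]
    char_fun_pos[OF assms] sonine_kernel_pos by (auto simp: less_imp_le)

lemma sonine_kernel_upper_bound:
  assumes T: "0 < T"
  obtains C where "0 < C" "\<And>t. 0 < t \<Longrightarrow> t \<le> T \<Longrightarrow> sonine_kernel t \<le> C * t powr (a - 1)"
proof -
  \<comment> \<open>Enlarging \<open>T\<close> to at least 1 makes \<open>t powr (a - \<alpha>)\<close>, whose exponent is at most 0, bounded
    below uniformly in \<open>\<alpha>\<close>.\<close>
  define T' where "T' = max 1 T"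
  define m where "m = measure \<nu> UNIV * T' powr (a - b)"
  have m: "0 < m" using mass_pos by (simp add: m_def T'_def)
  have "sonine_kernel t \<le> exp 1 / m * t powr (a - 1)" if t: "0 < t" "t \<le> T" for t
  proof -
    have "measure \<nu> UNIV * (T' powr (a - b) * t powr (- a)) \<le> char_fun (1 / t)"
    proof (rule char_fun_ge)
      fix \<alpha> assume \<alpha>: "a \<le> \<alpha>" "\<alpha> \<le> b"
      have "T' powr (a - b) \<le> T' powr (a - \<alpha>)" using \<alpha> by (intro powr_mono) (auto simp: T'_def)
      also have "\<dots> \<le> t powr (a - \<alpha>)" using \<alpha> t by (intro powr_mono2') (auto simp: T'_def)
      finally have "T' powr (a - b) * t powr (- a) \<le> t powr (a - \<alpha>) * t powr (- a)"
        by (intro mult_right_mono) auto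
      also have "\<dots> = (1 / t) powr \<alpha>" using t by (simp add: powr_minus powr_divide powr_diff divide_simps)
      finally show "T' powr (a - b) * t powr (- a) \<le> (1 / t) powr \<alpha>" .
    qed (use t in simp)
    then have P: "m * t powr (- a) \<le> char_fun (1 / t)" by (simp add: m_def mult.assoc)
    have "sonine_kernel t * t \<le> exp 1 * (1 / char_fun (1 / t))"
      using le_laplace_if_antimono[of t sonine_kernel] laplace_sonine_kernel[of "1 / t"] t
        sonine_kernel_antimono sonine_kernel_pos by (auto simp: less_imp_le)
    also have "\<dots> \<le> exp 1 * (1 / (m * t powr (- a)))"
      using P m t by (intro mult_left_mono divide_left_mono) (auto intro!: mult_pos_pos char_fun_pos)
    also have "\<dots> = exp 1 / m * t powr (a - 1) * t"
      using t by (simp add: powr_minus powr_diff field_simps)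
    finally show ?thesis by (rule mult_right_le_imp_le) (use t in simp)
  qed
  then show thesis using that[of "exp 1 / m"] m by simp
qed

end

theorem proposition7:
  fixes \<nu> :: "real measure" and a b :: real
  assumes "0 < a" and "a \<le> b" and "b < 1"
    and "sets \<nu> = sets borel"
    and "finite_measure \<nu>"
    and "emeasure \<nu> UNIV \<noteq> 0"
    and "emeasure \<nu> (- {a..b}) = 0"
  shows "\<exists>\<kappa> :: real \<Rightarrow> real.
    completely_monotone \<kappa> \<and>
    L1_loc \<kappa> \<and>
    sonine_pair_on {0<..} \<kappa> (k_ker \<nu>) \<and>
    (\<forall>z>0. laplace \<kappa> z = inverse (LINT \<alpha>:{a..b}|\<nu>. z powr \<alpha>)) \<and>
    (\<forall>t>0. \<kappa> t > 0) \<and>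
    (\<forall>T>0. \<exists>C. \<forall>t. 0 < t \<and> t \<le> T \<longrightarrow> 0 < \<kappa> t \<and> \<kappa> t \<le> C * t powr (a - 1)) \<and>
    (\<forall>T>0.
       L1_on T \<kappa> \<and> L1_on T (k_ker \<nu>) \<and>
       sonine_pair_on {0<..T} \<kappa> (k_ker \<nu>) \<and>
       (\<exists>C>0. \<exists>\<eta>>0. \<forall>t. 0 < t \<and> t \<le> T \<longrightarrow> \<bar>\<kappa> t\<bar> \<le> C * t powr (\<eta> - 1)) \<and>
       (\<forall>\<epsilon>>0. \<not> (AE t in lborel. t \<in> {0<..<\<epsilon>} \<longrightarrow> \<kappa> t = 0)) \<and>
       volterra_inj_on_C TYPE(real) T \<kappa> \<and>
       volterra_inj_on_C TYPE(complex) T \<kappa>)"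
proof -
  interpret finite_measure \<nu> by fact
  interpret order_distribution \<nu> a b by unfold_locales fact+
  let ?\<kappa> = sonine_kernel
  have \<kappa>_nonneg: "0 \<le> ?\<kappa> t" if "0 < t" for t using sonine_kernel_pos[OF that] by simp
  have \<kappa>_L1: "L1_loc ?\<kappa>"
    using L1_loc_if_laplace_integrable[OF measurable_sonine_kernel laplace_sonine_kernel(1)[of 1]] by simp
  have k_L1: "L1_loc (k_ker \<nu>)"
    using L1_loc_if_laplace_integrable[OF measurable_k_ker
        laplace_eq_if_nn_laplace(1)[OF measurable_k_ker _ _ nn_laplace_k_ker[of 1]]]
      k_ker_nonneg char_fun_pos[of 1] by simp
  have lap: "laplace ?\<kappa> z = inverse (LINT \<alpha>:{a..b}|\<nu>. z powr \<alpha>)" if z: "0 < z" for z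
  proof -
    have "(LINT \<alpha>:{a..b}|\<nu>. z powr \<alpha>) = char_fun z"
      unfolding char_fun_def set_lebesgue_integral_def
    proof (rule integral_cong_AE)
      show "AE \<alpha> in \<nu>. indicator {a..b} \<alpha> *\<^sub>R z powr \<alpha> = z powr \<alpha>"
        using AE_order by eventually_elim auto
    qed measurable
    then show ?thesis using laplace_sonine_kernel(2)[OF z] by (simp add: inverse_eq_divide)
  qed
  have bound: "\<exists>C>0. \<forall>t. 0 < t \<and> t \<le> T \<longrightarrow> ?\<kappa> t \<le> C * t powr (a - 1)" if "0 < T" for T
    using sonine_kernel_upper_bound[OF that] by metis
  have nonzero: "\<not> (AE t in lborel. t \<in> {0<..<\<epsilon>} \<longrightarrow> ?\<kappa> t = 0)" if \<epsilon>: "0 < \<epsilon>" for \<epsilon>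
  proof
    assume "AE t in lborel. t \<in> {0<..<\<epsilon>} \<longrightarrow> ?\<kappa> t = 0"
    then have "AE t in lborel. t \<notin> {0<..<\<epsilon>}"
      by eventually_elim (use sonine_kernel_pos in force)
    then have "emeasure lborel {0<..<\<epsilon>} = 0"
      by (subst (asm) AE_iff_measurable[where N = "{0<..<\<epsilon>}"]) auto
    then show False using \<epsilon> by simp
  qed
  have inj: "volterra_inj_on_C TYPE('b::euclidean_space) T ?\<kappa>" if "0 < T" for T
    by (rule volterra_inj_if_sonine[OF measurable_sonine_kernel measurable_k_ker _ _ sonine_pair that])
       (auto intro: \<kappa>_nonneg k_ker_nonneg)
  show ?thesis
  proof (intro exI[of _ ?\<kappa>] conjI allI impI)
    fix T :: real assume T: "0 < T"
    show "\<exists>C. \<forall>t. 0 < t \<and> t \<le> T \<longrightarrow> 0 < ?\<kappa> t \<and> ?\<kappa> t \<le> C * t powr (a - 1)"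
      using bound[OF T] sonine_kernel_pos by blast
    show "\<exists>C>0. \<exists>\<eta>>0. \<forall>t. 0 < t \<and> t \<le> T \<longrightarrow> \<bar>?\<kappa> t\<bar> \<le> C * t powr (\<eta> - 1)"
      using bound[OF T] a_pos \<kappa>_nonneg by (metis abs_of_nonneg)
    show "sonine_pair_on {0<..T} ?\<kappa> (k_ker \<nu>)"
      using sonine_pair by (simp add: sonine_pair_on_def)
    show "L1_on T ?\<kappa>" "L1_on T (k_ker \<nu>)" using \<kappa>_L1 k_L1 T by (auto simp: L1_loc_def)
    show "volterra_inj_on_C TYPE(real) T ?\<kappa>" "volterra_inj_on_C TYPE(complex) T ?\<kappa>"
      using T by (rule inj)+
  qed (use completely_monotone_sonine_kernel \<kappa>_L1 sonine_pair lap sonine_kernel_pos nonzero in auto)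
qed

end
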